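(* Assume Setting A with $\psi_\theta(x,y_k)=G(h_X(x),h_Y(y_k),\theta)$ as described in the context, and let $\hat\lambda^{(n)}$ be measurable estimators satisfying (N2) $\hat\lambda^{(n)}\to\lambda^\circ$ in probability. Suppose the moment condition (MC) holds: there is $\varepsilon^\circ>0$ such that, with $B(\theta^\circ)=\{\theta:\|\theta-\theta^\circ\|\le\varepsilon^\circ\}$ and $\mathbf Z_k=h_X(X_k)$, the random variables $\sup_{\theta\in B(\theta^\circ)}H_r(\mathbf Z_k\mid\theta)^3$, $\sup_{\theta\in B(\theta^\circ)}H_{st}(\mathbf Z_k\mid\theta)^2$ and $\sup_{\theta\in B(\theta^\circ)}H_{rst}(\mathbf Z_k\mid\theta)$ have finite expectation for all $r,s,t\in\{1,\dots,S\}$ and $k\in\{0,\dots,K\}$. Then (N3) $\frac1n\int_0^1\mathbf J^{(n)}(\lambda^\circ+t[\hat\lambda^{(n)}-\lambda^\circ])\,dt\to\bar{\mathbf I}(\lambda^\circ)$ in probability and (N4) $\frac1n\mathbf J^{(n)}(\hat\lambda^{(n)})\to\bar{\mathbf I}(\lambda^\circ)$ in probability.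
   Context: Setting A. Let $(\Omega_X,\mathcal B_X)$, $(\Omega_Y,\mathcal B_Y)$ be measurable spaces with a $\sigma$-finite measure $\nu_X$ on $\Omega_X$. Fix $K\ge1$, distinct $y_0,\dots,y_K\in\Omega_Y$, $S\ge1$, and for $\theta\in\mathbb R^S$ and $k=0,\dots,K$ measurable functions $x\mapsto\psi_\theta(x,y_k)$ on $\Omega_X$ with $\psi_\theta(x,y_0)=0$, such that $\theta\mapsto\psi_\theta(x,y_k)$ is three times continuously differentiable for every $x$. Let $\theta^\circ\in\mathbb R^S$ (true parameter) and for each $k$ let $f_k$ be an everywhere positive probability density on $\Omega_X$ w.r.t. $\nu_X$ of the form $\log f_k(x)=\beta(x)+\psi_{\theta^\circ}(x,y_k)-\varepsilon_k$ with a measurable $\beta$ and constants $\varepsilon_k$ (these are the conditional densities of $X$ given $Y=y_k$ under the association model with log-odds ratio $\psi_{\theta^\circ}$). $X_k$ denotes a random element with density $f_k$. Fix $\bar r_0,\dots,\bar r_K>0$ with $\sum_k\bar r_k=1$. On a common probability space let $(X_{ki})_{i\ge1}$, $k=0,\dots,K$, be independent i.i.d. sequences with $X_{ki}\sim X_k$; for $n$ in an increasing sequence with $n_k=\bar r_kn\in\mathbb N$ for all $k$, the sample is $\{X_{ki}:k=0,\dots,K,\ i\le n_k\}$. For $\lambda=(\theta,\gamma^* )\in\mathbb R^S\times\mathbb R^K$, $\gamma^*=(\gamma_1^*,\dots,\gamma_K^* )$, $\gamma_0^*:=0$, put $p_k^*(x;\lambda)=\exp(\gamma_k^*+\psi_\theta(x,y_k))/\sum_{l=0}^K\exp(\gamma_l^*+\psi_\theta(x,y_l))$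 and $\ell^{(n)}(\lambda)=\sum_{k=0}^K\sum_{i=1}^{n_k}\log p_k^*(X_{ki};\lambda)$. The true value is $\lambda^\circ=(\theta^\circ,\gamma^\circ)$ with $\gamma_k^\circ=\log\bar r_k-\varepsilon_k-\log\bar r_0+\varepsilon_0$, so that $p_k^*(x;\lambda^\circ)=\bar r_kf_k(x)/\sum_l\bar r_lf_l(x)$. $D_\lambda$ denotes the gradient in $\lambda$, $\mathbf J^{(n)}(\lambda)=-D^2_{\lambda\lambda}\ell^{(n)}(\lambda)$; $E$, $\mathrm{Cov}$, $P$ refer to the true distribution. Define $\bar{\mathbf I}(\lambda)=\sum_k\bar r_kE[-D^2_{\lambda\lambda}\log p_k^*(X_k;\lambda)]$, $\bar{\boldsymbol\Sigma}(\lambda)=\sum_k\bar r_k\mathrm{Cov}(D_\lambda\log p_k^*(X_k;\lambda))$, $\mathbf I(\lambda)=n\bar{\mathbf I}(\lambda)=E\mathbf J^{(n)}(\lambda)$, $\boldsymbol\Sigma(\lambda)=n\bar{\boldsymbol\Sigma}(\lambda)=\mathrm{Cov}(D_\lambda\ell^{(n)}(\lambda))$. Additional structure: measurable maps $h_X:\Omega_X\to\mathbb R^{K_X}$, $h_Y:\Omega_Y\to\mathbb R^{K_Y}$ and a function $G(\mathbf z,\mathbf v,\theta)$ with $G(\mathbf z,\mathbf 0,\theta)=G(\mathbf 0,\mathbf v,\theta)=0$, $h_Y(y_0)=\mathbf 0$, such that (R1) $G(\mathbf z,\mathbf v,\theta)$ is three times continuously differentiable in $\theta$ for all $\mathbf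 z\in h_X[\Omega_X]$, $\mathbf v\in h_Y[\Omega_Y]$, with derivatives continuous in $\mathbf z,\mathbf v$. Define $H_r(\mathbf z\mid\theta)=\sum_{k=0}^K|D_{\theta_r}G(\mathbf z,h_Y(y_k),\theta)|$, $H_{rs}(\mathbf z\mid\theta)=\sum_{k=0}^K|D^2_{\theta_r\theta_s}G(\mathbf z,h_Y(y_k),\theta)|$, $H_{rst}(\mathbf z\mid\theta)=\sum_{k=0}^K|D^3_{\theta_r\theta_s\theta_t}G(\mathbf z,h_Y(y_k),\theta)|$. *)

theory Defs
  imports "HOL-Probability.Probability"
begin

definition pd :: "('a::real_normed_vector \<Rightarrow> real) \<Rightarrow> 'a \<Rightarrow> 'a \<Rightarrow> real" where
  "pd F b x = deriv (\<lambda>t. F (x + t *\<^sub>R b)) 0"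

definition hess :: "('a::real_normed_vector \<Rightarrow> real) \<Rightarrow> 'a \<Rightarrow> 'a \<Rightarrow> 'a \<Rightarrow> real" where
  "hess F b c x = pd (\<lambda>y. pd F b y) c x"

definition pd3 :: "('a::real_normed_vector \<Rightarrow> real) \<Rightarrow> 'a \<Rightarrow> 'a \<Rightarrow> 'a \<Rightarrow> 'a \<Rightarrow> real" where
  "pd3 F b c d x = pd (\<lambda>y. hess F b c y) d x"

fun Ck :: "nat \<Rightarrow> ('a::euclidean_space \<Rightarrow> real) \<Rightarrow> bool" where
  "Ck 0 F = continuous_on UNIV F"
| "Ck (Suc k) F = (continuous_on UNIV F \<and>
      (\<forall>b\<in>Basis. \<forall>x. (\<lambda>t. F (x + t *\<^sub>R b)) differentiable (at 0)) \<and>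
      (\<forall>b\<in>Basis. Ck k (pd F b)))"

text \<open>Indices k = 0..K are represented by 'k option, with None standing for 0
  and Some j for the K indices 1..K (K = CARD('k)).
  A parameter lambda = (theta, gamma*) lives in (real^'s) \<times> (real^'k).\<close>

definition gam :: "(real^'s) \<times> (real^'k) \<Rightarrow> 'k option \<Rightarrow> real" where
  "gam lam k = (case k of None \<Rightarrow> 0 | Some j \<Rightarrow> snd lam $ j)"

definition pstar :: "(real^'s \<Rightarrow> 'x \<Rightarrow> 'k::finite option \<Rightarrow> real) \<Rightarrow> 'k option \<Rightarrow> 'x
                     \<Rightarrow> (real^'s) \<times> (real^'k) \<Rightarrow> real" where
  "pstar psi k x lam =
     exp (gam lam k + psi (fst lam) x k) / (\<Sum>l\<in>UNIV. exp (gam lam l + psi (fst lam) x l))"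

definition loglik :: "(real^'s \<Rightarrow> 'x \<Rightarrow> 'k::finite option \<Rightarrow> real) \<Rightarrow> ('k option \<Rightarrow> nat \<Rightarrow> 'w \<Rightarrow> 'x)
                      \<Rightarrow> ('k option \<Rightarrow> nat) \<Rightarrow> 'w \<Rightarrow> (real^'s) \<times> (real^'k) \<Rightarrow> real" where
  "loglik psi X ns w lam = (\<Sum>k\<in>UNIV. \<Sum>i<ns k. ln (pstar psi k (X k i w) lam))"

definition Jn :: "(real^'s \<Rightarrow> 'x \<Rightarrow> 'k::finite option \<Rightarrow> real) \<Rightarrow> ('k option \<Rightarrow> nat \<Rightarrow> 'w \<Rightarrow> 'x)
                  \<Rightarrow> ('k option \<Rightarrow> nat) \<Rightarrow> 'w \<Rightarrow> (real^'s) \<times> (real^'k)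
                  \<Rightarrow> (real^'s) \<times> (real^'k) \<Rightarrow> (real^'s) \<times> (real^'k) \<Rightarrow> real" where
  "Jn psi X ns w lam b c = - hess (loglik psi X ns w) b c lam"

text \<open>(b,c) entry of Ibar(lambda) = sum_k rbar_k E[- D^2 log p*_k(X_k; lambda)],
  X_k having density f_k w.r.t. nu.\<close>
definition Ibar :: "'x measure \<Rightarrow> ('k::finite option \<Rightarrow> 'x \<Rightarrow> real) \<Rightarrow> ('k option \<Rightarrow> real)
                    \<Rightarrow> (real^'s \<Rightarrow> 'x \<Rightarrow> 'k option \<Rightarrow> real) \<Rightarrow> (real^'s) \<times> (real^'k)
                    \<Rightarrow> (real^'s) \<times> (real^'k) \<Rightarrow> (real^'s) \<times> (real^'k) \<Rightarrow> real" where
  "Ibar nu f r psi lam b c =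
     (\<Sum>k\<in>UNIV. r k * (\<integral>x. - hess (\<lambda>l. ln (pstar psi k x l)) b c lam
                          \<partial>(density nu (\<lambda>x. ennreal (f k x)))))"

definition gamma0 :: "('k::finite option \<Rightarrow> real) \<Rightarrow> ('k option \<Rightarrow> real) \<Rightarrow> real^'k" where
  "gamma0 r eps = (\<chi> j. ln (r (Some j)) - eps (Some j) - ln (r None) + eps None)"

text \<open>H_r, H_rs, H_rst; r s t range over the basis (coordinate) vectors of real^'s.\<close>
definition Hr :: "('z \<Rightarrow> 'v \<Rightarrow> real^'s \<Rightarrow> real) \<Rightarrow> ('y \<Rightarrow> 'v) \<Rightarrow> ('k::finite option \<Rightarrow> 'y)
                  \<Rightarrow> real^'s \<Rightarrow> 'z \<Rightarrow> real^'s \<Rightarrow> real" where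
  "Hr G hY y r z \<theta> = (\<Sum>k\<in>UNIV. \<bar>pd (G z (hY (y k))) r \<theta>\<bar>)"

definition Hrs :: "('z \<Rightarrow> 'v \<Rightarrow> real^'s \<Rightarrow> real) \<Rightarrow> ('y \<Rightarrow> 'v) \<Rightarrow> ('k::finite option \<Rightarrow> 'y)
                  \<Rightarrow> real^'s \<Rightarrow> real^'s \<Rightarrow> 'z \<Rightarrow> real^'s \<Rightarrow> real" where
  "Hrs G hY y r s z \<theta> = (\<Sum>k\<in>UNIV. \<bar>hess (G z (hY (y k))) r s \<theta>\<bar>)"

definition Hrst :: "('z \<Rightarrow> 'v \<Rightarrow> real^'s \<Rightarrow> real) \<Rightarrow> ('y \<Rightarrow> 'v) \<Rightarrow> ('k::finite option \<Rightarrow> 'y)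
                  \<Rightarrow> real^'s \<Rightarrow> real^'s \<Rightarrow> real^'s \<Rightarrow> 'z \<Rightarrow> real^'s \<Rightarrow> real" where
  "Hrst G hY y r s t z \<theta> = (\<Sum>k\<in>UNIV. \<bar>pd3 (G z (hY (y k))) r s t \<theta>\<bar>)"

definition conv_in_prob :: "'w measure \<Rightarrow> (nat \<Rightarrow> 'w \<Rightarrow> 'a::metric_space) \<Rightarrow> 'a \<Rightarrow> bool" where
  "conv_in_prob M Y c \<longleftrightarrow>
     (\<forall>e>0. (\<lambda>m. measure M {w \<in> space M. dist (Y m w) c > e}) \<longlonglongrightarrow> 0)"

definition sample_sigma :: "'w measure \<Rightarrow> 'x measure \<Rightarrow> ('k \<Rightarrow> nat \<Rightarrow> 'w \<Rightarrow> 'x)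
                            \<Rightarrow> ('k \<Rightarrow> nat) \<Rightarrow> 'w measure" where
  "sample_sigma M nu X n =
     sigma (space M) {X k i -` A \<inter> space M | k i A. i < n k \<and> A \<in> sets nu}"

end

theory Submission
  imports Defs "HOL-Real_Asymp.Real_Asymp"
begin

text \<open>
  With \<open>u\<^sub>l\<close> the linear predictor of category \<open>l\<close> and \<open>p\<close> the softmax of \<open>u\<close>, the Hessian of \<open>log p\<^sub>k\<close> is an
  explicit polynomial in \<open>p\<close> and the first and second partial derivatives of \<open>u\<close>. By the moment condition
  there is an integrable envelope \<open>W \<ge> 1\<close> such that in a ball around the true parameter the derivatives of
  order 1, 2, 3 are bounded by \<open>W\<close> to the powers 1/3, 1/2, 1. Hence the Hessian at \<open>\<lambda>\<close> differs from
  the one at the true parameter by at most a constant times \<open>W\<close> times the distance of \<open>\<lambda>\<close> from the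
  true parameter.
  At the true parameter the averaged Hessian converges by the weak law of large numbers, the
  sample means of \<open>W\<close> converge as well, and consistency of the estimators makes the remaining
  difference vanish, both at the estimator and on the whole segment joining it to the true parameter.
\<close>

subsection \<open>Partial derivatives\<close>

text \<open>The estimator depends on the whole sample, so the summands of the Hessian at the
  estimator are not independent and no law of large numbers applies to them directly. The Lipschitz
  estimate separates the two sources of randomness: all dependence on the estimator sits in the
  distance, while \<open>W\<close> is a fixed function of a single observation. Comparison with the
  centre alone is enough, since both conclusions only involve points no farther from the true
  parameter than the estimator. A second concern is the notion of smoothness. \<open>Ck\<close>
  speaks of iterated partial derivatives along coordinate lines, and \<open>deriv\<close> has an
  unspecified value where no derivative exists. Formulas for derivatives of sums and products
  therefore rest on existence statements, and increments are estimated along coordinate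
  lines.\<close>

lemma Ck_pd: "Ck (Suc k) F \<Longrightarrow> b \<in> Basis \<Longrightarrow> Ck k (pd F b)"
  by simp

lemma Ck_imp_continuous: "Ck k F \<Longrightarrow> continuous_on UNIV F"
  by (cases k) auto

text \<open>\<open>Ck\<close> asks for differentiability at parameter 0 but for every base point;
  moving the base point along the line yields it at every \<open>t\<close>, as a mean value bound on
  that line requires.\<close>

lemma has_real_derivative_pd:
  assumes "Ck (Suc k) F" "b \<in> Basis"
  shows "((\<lambda>t. F (x + t *\<^sub>R b)) has_real_derivative pd F b (x + t *\<^sub>R b)) (at t)"
proof -
  have "(\<lambda>s. F ((x + t *\<^sub>R b) + s *\<^sub>R b)) differentiable (at 0)"
    using assms by auto
  then have "((\<lambda>s. F ((x + t *\<^sub>R b) + s *\<^sub>R b)) has_real_derivative pd F b (x + t *\<^sub>R b)) (at 0)"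
    by (simp add: pd_def DERIV_deriv_iff_real_differentiable)
  then have "((\<lambda>s. F (x + (s + t) *\<^sub>R b)) has_real_derivative pd F b (x + t *\<^sub>R b)) (at 0)"
    by (simp add: algebra_simps)
  then show ?thesis
    using DERIV_shift[of "\<lambda>t. F (x + t *\<^sub>R b)" _ 0 t] by simp
qed

lemma pd_eqI:
  assumes "((\<lambda>t. F (x + t *\<^sub>R b)) has_real_derivative D) (at 0)"
  shows "pd F b x = D"
  using assms by (simp add: pd_def DERIV_imp_deriv)

lemma pd_const: "pd (\<lambda>_. c) b = (\<lambda>_. 0)"
  by (auto simp: pd_def)

text \<open>No smoothness of \<open>F\<close> enters: adding a constant leaves the set of admissible
  derivative values unchanged, hence also the value that \<open>deriv\<close> selects from
  it.\<close>

lemma pd_const_add: "pd (\<lambda>x. c + F x) b = pd F b"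
proof -
  have "((\<lambda>t. c + f t) has_real_derivative D) (at 0) \<longleftrightarrow> (f has_real_derivative D) (at 0)"
    for f :: "real \<Rightarrow> real" and D
    using DERIV_add[OF DERIV_const[of c], of f D 0 UNIV]
      DERIV_add[OF DERIV_const[of "- c"], of "\<lambda>t. c + f t" D 0 UNIV] by auto
  then show ?thesis by (simp add: pd_def deriv_def fun_eq_iff)
qed

lemma Ck_const: "Ck k (\<lambda>_. c)"
  by (induction k arbitrary: c) (auto simp: pd_const)

lemma pd_add:
  assumes "Ck (Suc k) F" "Ck (Suc k) H" "b \<in> Basis"
  shows "pd (\<lambda>x. F x + H x) b = (\<lambda>x. pd F b x + pd H b x)"
proof
  fix x
  show "pd (\<lambda>x. F x + H x) b x = pd F b x + pd H b x"
    using has_real_derivative_pd[OF assms(1,3), of x 0] has_real_derivative_pd[OF assms(2,3), of x 0]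
    by (intro pd_eqI DERIV_add) auto
qed

lemma Ck_add:
  assumes "Ck k F" "Ck k H"
  shows "Ck k (\<lambda>x. F x + H x)"
  using assms
proof (induction k arbitrary: F H)
  case 0
  then show ?case by (auto intro: continuous_intros)
next
  case (Suc k)
  have "Ck k (pd (\<lambda>x. F x + H x) b)" if "b \<in> Basis" for b
    using Suc.IH[of "pd F b" "pd H b"] Suc.prems that by (simp add: pd_add[OF Suc.prems that])
  then show ?case
    using Suc.prems by (auto intro!: continuous_intros differentiable_add)
qed

lemma pd_fst: "pd (\<lambda>p. F (fst p)) b = (\<lambda>p. pd F (fst b) (fst p))"
  by (auto simp: pd_def)

lemma pd_zero: "pd F 0 = (\<lambda>_. 0)"
  by (auto simp: pd_def)

text \<open>A basis vector of the product projects to a basis vector or to 0; in the second case the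
  partial derivative vanishes identically.\<close>

lemma Ck_fst:
  fixes F :: "'a::euclidean_space \<Rightarrow> real"
  assumes "Ck k F"
  shows "Ck k (\<lambda>p::'a \<times> 'b::euclidean_space. F (fst p))"
  using assms
proof (induction k arbitrary: F)
  case 0
  then show ?case
    by (auto intro!: continuous_on_compose2[of UNIV F] continuous_intros)
next
  case (Suc k)
  have "Ck k (\<lambda>p::'a \<times> 'b. pd F (fst b) (fst p))" if "b \<in> Basis" for b :: "'a \<times> 'b"
    using that Suc by (auto simp: Basis_prod_def pd_zero Ck_const)
  then show ?case
    using Suc.prems
    by (auto simp: pd_fst Basis_prod_def intro!: continuous_on_compose2[of UNIV F] continuous_intros)
qed

text \<open>Affinity along coordinate lines makes every first partial derivative constant, and
  constants are smooth of any order. Meant for the intercepts \<open>gam\<close>.\<close>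

lemma Ck_linear_of_pd_const:
  assumes "continuous_on UNIV F" "\<And>b x t. b \<in> Basis \<Longrightarrow> F (x + t *\<^sub>R b) = F x + t * F b"
  shows "Ck k F" and "b \<in> Basis \<Longrightarrow> pd F b = (\<lambda>_. F b)"
proof -
  show *: "pd F b = (\<lambda>_. F b)" if "b \<in> Basis" for b
    by (rule ext, rule pd_eqI) (auto simp: assms(2)[OF that] intro!: derivative_eq_intros)
  show "Ck k F"
    using assms by (cases k) (auto simp: * Ck_const)
qed

text \<open>
  Move from the centre to the target one coordinate at a time: every point on this path is
  componentwise dominated by the target and hence stays in the ball, so only partial
  derivatives are needed.
\<close>

lemma pd_bound_imp_lipschitz_at_centre:
  fixes F :: "'a::euclidean_space \<Rightarrow> real"
  assumes F: "Ck (Suc k) F"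
    and bnd: "\<And>b y. b \<in> Basis \<Longrightarrow> y \<in> cball x e \<Longrightarrow> \<bar>pd F b y\<bar> \<le> L"
    and z: "z \<in> cball x e"
  shows "\<bar>F z - F x\<bar> \<le> real DIM('a) * dist z x * L"
proof -
  define v where "v = z - x"
  define P where "P S = x + (\<Sum>i\<in>S. (v \<bullet> i) *\<^sub>R i)" for S
  have nv: "norm v \<le> e"
    using z by (simp add: v_def dist_norm norm_minus_commute)
  have "\<bar>F (P S) - F x\<bar> \<le> real (card S) * (norm v * L)" if "finite S" "S \<subseteq> Basis" for S
    using that
  proof (induction S)
    case empty
    then show ?case by (simp add: P_def)
  next
    case (insert j S)
    define g where "g t = F (P S + t *\<^sub>R j)" for t
    have j: "j \<in> Basis" "S \<subseteq> Basis" "finite S" "j \<notin> S"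
      using insert by auto
    have ins: "P (insert j S) = P S + (v \<bullet> j) *\<^sub>R j"
      using j by (simp add: P_def algebra_simps)
    have inball: "P S + t *\<^sub>R j \<in> cball x e" if "\<bar>t\<bar> \<le> \<bar>v \<bullet> j\<bar>" for t
    proof -
      have "norm ((\<Sum>i\<in>S. (v \<bullet> i) *\<^sub>R i) + t *\<^sub>R j) \<le> norm v"
      proof (rule norm_le_componentwise)
        fix b :: 'a assume b: "b \<in> Basis"
        have eq: "(\<Sum>i\<in>S. (v \<bullet> i) * (i \<bullet> b)) = (\<Sum>i\<in>S. if i = b then v \<bullet> b else 0)"
          using j b by (intro sum.cong refl) (auto simp: inner_Basis)
        show "\<bar>((\<Sum>i\<in>S. (v \<bullet> i) *\<^sub>R i) + t *\<^sub>R j) \<bullet> b\<bar> \<le> \<bar>v \<bullet> b\<bar>"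
          using j b that
          by (auto simp: inner_add_left inner_sum_left eq inner_Basis)
      qed
      moreover have "dist (P S + t *\<^sub>R j) x = norm ((\<Sum>i\<in>S. (v \<bullet> i) *\<^sub>R i) + t *\<^sub>R j)"
        by (simp add: P_def dist_norm)
      ultimately show ?thesis
        using nv by (simp add: dist_commute)
    qed
    have "norm (g (v \<bullet> j) - g 0) \<le> L * norm (v \<bullet> j - 0)"
    proof (rule field_differentiable_bound[of "cball 0 \<bar>v \<bullet> j\<bar>"])
      fix t :: real assume "t \<in> cball 0 \<bar>v \<bullet> j\<bar>"
      then have t: "\<bar>t\<bar> \<le> \<bar>v \<bullet> j\<bar>" by simp
      show "(g has_field_derivative pd F j (P S + t *\<^sub>R j)) (at t within cball 0 \<bar>v \<bullet> j\<bar>)"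
        unfolding g_def by (rule has_field_derivative_at_within[OF has_real_derivative_pd[OF F j(1)]])
      show "norm (pd F j (P S + t *\<^sub>R j)) \<le> L"
        using bnd[OF j(1) inball[OF t]] by simp
    qed auto
    then have "\<bar>F (P (insert j S)) - F (P S)\<bar> \<le> \<bar>v \<bullet> j\<bar> * L"
      by (simp add: g_def ins mult.commute)
    \<comment> \<open>Replacing the single component by the norm of \<open>v\<close> in every step
      is what produces the factor \<open>DIM('a)\<close>.\<close>
    also have "\<dots> \<le> norm v * L"
    proof (rule mult_right_mono)
      show "\<bar>v \<bullet> j\<bar> \<le> norm v" using j by (simp add: Basis_le_norm)
      show "0 \<le> L" using bnd[OF j(1) inball[of 0]] by force
    qed
    finally have "\<bar>F (P (insert j S)) - F x\<bar> \<le> norm v * L + real (card S) * (norm v * L)"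
      using insert.IH j by linarith
    then show ?case using j by (simp add: algebra_simps)
  qed
  from this[OF finite_Basis subset_refl] show ?thesis
    by (simp add: P_def euclidean_representation v_def dist_norm mult.assoc)
qed

subsection \<open>The softmax map and the logarithm of its components\<close>

definition softmax :: "('k::finite \<Rightarrow> real) \<Rightarrow> 'k \<Rightarrow> real" where
  "softmax a k = exp (a k) / (\<Sum>l\<in>UNIV. exp (a l))"

lemma sum_exp_pos: "(\<Sum>l\<in>(UNIV::'k::finite set). exp (a l :: real)) > 0"
  by (rule sum_pos) auto

lemma softmax_pos: "softmax a k > 0"
  by (simp add: softmax_def sum_exp_pos)

lemma sum_softmax: "(\<Sum>k\<in>UNIV. softmax a k) = 1"
  using sum_exp_pos[of a] by (simp add: softmax_def flip: sum_divide_distrib)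

lemma softmax_le_1: "softmax a k \<le> 1"
  using sum_softmax[of a] member_le_sum[of k UNIV "softmax a"] softmax_pos[of a]
  by (auto intro: less_imp_le)

text \<open>Written as probability times deviation from the weighted mean, the derivative again
  involves only softmax values and the derivatives \<open>d\<close>, so the form survives a second
  differentiation.\<close>

lemma has_real_derivative_softmax:
  assumes "\<And>l. ((\<lambda>t. a t l) has_real_derivative d l) (at t within S)"
  shows "((\<lambda>t. softmax (a t) k) has_real_derivative
           softmax (a t) k * (d k - (\<Sum>l\<in>UNIV. softmax (a t) l * d l))) (at t within S)"
proof -
  let ?s = "\<Sum>l\<in>UNIV. exp (a t l)"
  have s: "?s \<noteq> 0" using sum_exp_pos[of "a t"] by simp
  have "((\<lambda>t. softmax (a t) k) has_real_derivative
      (exp (a t k) * d k * ?s - exp (a t k) * (\<Sum>l\<in>UNIV. exp (a t l) * d l)) / (?s * ?s)) (at t within S)"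
    unfolding softmax_def using s assms
    by (auto intro!: derivative_eq_intros simp: mult.commute)
  moreover have "(exp (a t k) * d k * ?s - exp (a t k) * (\<Sum>l\<in>UNIV. exp (a t l) * d l)) / (?s * ?s)
      = softmax (a t) k * (d k - (\<Sum>l\<in>UNIV. softmax (a t) l * d l))"
    using s by (simp add: softmax_def divide_simps sum_divide_distrib[symmetric] algebra_simps)
  ultimately show ?thesis by simp
qed

lemma has_real_derivative_ln_softmax:
  assumes "\<And>l. ((\<lambda>t. a t l) has_real_derivative d l) (at t within S)"
  shows "((\<lambda>t. ln (softmax (a t) k)) has_real_derivative
           d k - (\<Sum>l\<in>UNIV. softmax (a t) l * d l)) (at t within S)"
proof -
  have "((\<lambda>t. ln (softmax (a t) k)) has_real_derivative 1 / softmax (a t) k *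
      (softmax (a t) k * (d k - (\<Sum>l\<in>UNIV. softmax (a t) l * d l)))) (at t within S)"
    by (rule DERIV_chain2[where f = ln and g = "\<lambda>t. softmax (a t) k", OF DERIV_ln_divide[OF softmax_pos]
          has_real_derivative_softmax[OF assms]])
  then show ?thesis using softmax_pos[of "a t" k] by simp
qed

lemma sum_softmax_mult_le:
  assumes "\<And>l. \<bar>d l\<bar> \<le> D"
  shows "\<bar>\<Sum>l\<in>UNIV. softmax a l * d l\<bar> \<le> D"
proof -
  have "\<bar>\<Sum>l\<in>UNIV. softmax a l * d l\<bar> \<le> (\<Sum>l\<in>UNIV. softmax a l * D)"
    using assms
    by (intro sum_abs[THEN order_trans] sum_mono) (simp add: abs_mult less_imp_le[OF softmax_pos] mult_left_mono)
  then show ?thesis by (simp add: sum_softmax flip: sum_distrib_right)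
qed

text \<open>Mean value theorem on the segment from \<open>b\<close> to \<open>a\<close>: the
  derivative is a probability times an increment minus a weighted mean of increments, and each of
  the two is at most \<open>d\<close>.\<close>

lemma softmax_lipschitz:
  assumes d: "\<And>l. \<bar>a l - b l\<bar> \<le> d"
  shows "\<bar>softmax a k - softmax b k\<bar> \<le> 2 * d"
proof -
  define u where "u t l = b l + t * (a l - b l)" for t l
  have "norm (softmax (u 1) k - softmax (u 0) k) \<le> 2 * d * norm (1 - 0 :: real)"
  proof (rule field_differentiable_bound[of "UNIV :: real set"])
    fix t :: real
    show "((\<lambda>t. softmax (u t) k) has_field_derivative
       softmax (u t) k * ((a k - b k) - (\<Sum>l\<in>UNIV. softmax (u t) l * (a l - b l)))) (at t within UNIV)"
      unfolding u_def by (rule has_real_derivative_softmax) (auto intro!: derivative_eq_intros)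
    have "\<bar>(a k - b k) - (\<Sum>l\<in>UNIV. softmax (u t) l * (a l - b l))\<bar> \<le> 2 * d"
      using d[of k] sum_softmax_mult_le[of "\<lambda>l. a l - b l" d "u t", OF d] by linarith
    then show "norm (softmax (u t) k * ((a k - b k) - (\<Sum>l\<in>UNIV. softmax (u t) l * (a l - b l)))) \<le> 2 * d"
      using softmax_le_1[of "u t" k] softmax_pos[of "u t" k] mult_mono[of "softmax (u t) k" 1 _ "2 * d"]
      by (simp add: abs_mult)
  qed auto
  moreover have "u 1 = a" "u 0 = b"
    by (auto simp: u_def)
  ultimately show ?thesis by simp
qed

section \<open>Derivatives of the log-softmax of smooth predictors\<close>

lemma has_real_derivative_ln_softmax_pd:
  assumes u: "\<And>l. Ck (Suc n) (u l)" and b: "b \<in> Basis"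
  shows "((\<lambda>t. ln (softmax (\<lambda>l. u l (x + t *\<^sub>R b)) k)) has_real_derivative
     pd (u k) b x - (\<Sum>l\<in>UNIV. softmax (\<lambda>l. u l x) l * pd (u l) b x)) (at 0)"
  using has_real_derivative_ln_softmax[of "\<lambda>t l. u l (x + t *\<^sub>R b)" "\<lambda>l. pd (u l) b x" 0 UNIV k]
    has_real_derivative_pd[OF u b, of _ x 0] by auto

lemma pd_ln_softmax:
  assumes u: "\<And>l. Ck (Suc n) (u l)" and b: "b \<in> Basis"
  shows "pd (\<lambda>x. ln (softmax (\<lambda>l. u l x) k)) b =
     (\<lambda>x. pd (u k) b x - (\<Sum>l\<in>UNIV. softmax (\<lambda>l. u l x) l * pd (u l) b x))"
  by (rule ext, rule pd_eqI, rule has_real_derivative_ln_softmax_pd[OF u b])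

text \<open>The first two terms are the second derivative of predictor \<open>k\<close> centred at
  its softmax mean; the last two are minus the softmax covariance of the first derivatives in
  directions \<open>b\<close> and \<open>c\<close>. The covariance is left expanded so that each
  piece can be estimated as a product.\<close>

lemma has_real_derivative_pd_ln_softmax:
  assumes u: "\<And>l. Ck (Suc (Suc n)) (u l)" and b: "b \<in> Basis" and c: "c \<in> Basis"
  shows "((\<lambda>t. pd (\<lambda>x. ln (softmax (\<lambda>l. u l x) k)) b (x + t *\<^sub>R c)) has_real_derivative
     hess (u k) b c x - (\<Sum>l\<in>UNIV. softmax (\<lambda>l. u l x) l * hess (u l) b c x)
     - (\<Sum>l\<in>UNIV. softmax (\<lambda>l. u l x) l * pd (u l) b x * pd (u l) c x)
     + (\<Sum>l\<in>UNIV. softmax (\<lambda>l. u l x) l * pd (u l) b x)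
       * (\<Sum>l\<in>UNIV. softmax (\<lambda>l. u l x) l * pd (u l) c x)) (at 0)"
proof -
  let ?p = "\<lambda>l. softmax (\<lambda>l. u l x) l"
  define m where "m = (\<Sum>l\<in>UNIV. ?p l * pd (u l) c x)"
  have u': "Ck (Suc n) (pd (u l) b)" for l
    using u b by simp
  have dp: "((\<lambda>t. softmax (\<lambda>l. u l (x + t *\<^sub>R c)) l) has_real_derivative
      ?p l * (pd (u l) c x - m)) (at 0)" for l
    using has_real_derivative_softmax[of "\<lambda>t l. u l (x + t *\<^sub>R c)" "\<lambda>l. pd (u l) c x" 0 UNIV l]
      has_real_derivative_pd[OF u c, of _ x 0] by (auto simp: m_def)
  have da: "((\<lambda>t. pd (u l) b (x + t *\<^sub>R c)) has_real_derivative hess (u l) b c x) (at 0)" for l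
    using has_real_derivative_pd[OF u' c, of l x 0] by (simp add: hess_def)
  have "((\<lambda>t. pd (\<lambda>x. ln (softmax (\<lambda>l. u l x) k)) b (x + t *\<^sub>R c)) has_real_derivative
     hess (u k) b c x -
      (\<Sum>l\<in>UNIV. ?p l * (pd (u l) c x - m) * pd (u l) b x + hess (u l) b c x * ?p l)) (at 0)"
    unfolding pd_ln_softmax[OF u b]
    by (intro DERIV_diff DERIV_sum da) (use DERIV_mult[OF dp da] in simp)
  also have "(\<Sum>l\<in>UNIV. ?p l * (pd (u l) c x - m) * pd (u l) b x + hess (u l) b c x * ?p l) =
     (\<Sum>l\<in>UNIV. ?p l * hess (u l) b c x) + (\<Sum>l\<in>UNIV. ?p l * pd (u l) b x * pd (u l) c x)
     - (\<Sum>l\<in>UNIV. ?p l * pd (u l) b x) * m"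
    by (simp add: sum_distrib_left sum.distrib sum_subtractf algebra_simps)
  finally show ?thesis
    by (simp add: m_def algebra_simps)
qed

lemma hess_ln_softmax:
  assumes u: "\<And>l. Ck (Suc (Suc n)) (u l)" and b: "b \<in> Basis" and c: "c \<in> Basis"
  shows "hess (\<lambda>x. ln (softmax (\<lambda>l. u l x) k)) b c x =
     hess (u k) b c x - (\<Sum>l\<in>UNIV. softmax (\<lambda>l. u l x) l * hess (u l) b c x)
     - (\<Sum>l\<in>UNIV. softmax (\<lambda>l. u l x) l * pd (u l) b x * pd (u l) c x)
     + (\<Sum>l\<in>UNIV. softmax (\<lambda>l. u l x) l * pd (u l) b x)
       * (\<Sum>l\<in>UNIV. softmax (\<lambda>l. u l x) l * pd (u l) c x)"
  unfolding hess_def[of "\<lambda>x. ln (softmax (\<lambda>l. u l x) k)"]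
  by (rule pd_eqI, rule has_real_derivative_pd_ln_softmax[OF u b c])

text \<open>Additivity of \<open>pd\<close> needs the summands to be differentiable, at the first
  order and again at the second; both facts come from the explicit derivatives above.\<close>

lemma hess_sum_ln_softmax:
  fixes u :: "'j \<Rightarrow> 'k::finite \<Rightarrow> 'a::euclidean_space \<Rightarrow> real"
  assumes u: "\<And>j l. j \<in> J \<Longrightarrow> Ck (Suc (Suc n)) (u j l)" and b: "b \<in> Basis" and c: "c \<in> Basis"
  shows "hess (\<lambda>x. \<Sum>j\<in>J. ln (softmax (\<lambda>l. u j l x) (\<kappa> j))) b c x =
     (\<Sum>j\<in>J. hess (\<lambda>x. ln (softmax (\<lambda>l. u j l x) (\<kappa> j))) b c x)"
proof -
  let ?F = "\<lambda>j x. ln (softmax (\<lambda>l. u j l x) (\<kappa> j))"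
  have 1: "((\<lambda>t. ?F j (x + t *\<^sub>R b)) has_real_derivative pd (?F j) b x) (at 0)" if "j \<in> J" for j x
    using has_real_derivative_ln_softmax_pd[OF u[OF that] b, where k = "\<kappa> j" and x = x]
    by (simp add: pd_ln_softmax[OF u[OF that] b])
  have 2: "((\<lambda>t. pd (?F j) b (x + t *\<^sub>R c)) has_real_derivative hess (?F j) b c x) (at 0)"
    if "j \<in> J" for j
    using has_real_derivative_pd_ln_softmax[OF u[OF that] b c, where k = "\<kappa> j" and x = x]
    by (simp only: hess_ln_softmax[OF u[OF that] b c])
  have "pd (\<lambda>x. \<Sum>j\<in>J. ?F j x) b = (\<lambda>x. \<Sum>j\<in>J. pd (?F j) b x)"
    by (rule ext, rule pd_eqI, rule DERIV_sum, rule 1)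
  then show ?thesis
    unfolding hess_def[of "\<lambda>x. \<Sum>j\<in>J. ?F j x"]
    by simp (rule pd_eqI, rule DERIV_sum, rule 2)
qed

lemma continuous_on_softmax:
  assumes "\<And>l. continuous_on S (u l)"
  shows "continuous_on S (\<lambda>x. softmax (\<lambda>l. u l x) k)"
proof -
  have "(\<Sum>l\<in>UNIV. exp (u l x)) \<noteq> 0" for x
    using sum_exp_pos[of "\<lambda>l. u l x"] by simp
  then show ?thesis
    unfolding softmax_def using assms by (intro continuous_intros) auto
qed

text \<open>Makes the Hessian integrable along the segment from the true parameter to the
  estimator.\<close>

lemma continuous_on_hess_ln_softmax:
  assumes u: "\<And>l. Ck (Suc (Suc n)) (u l)" and b: "b \<in> Basis" and c: "c \<in> Basis"
  shows "continuous_on UNIV (hess (\<lambda>x. ln (softmax (\<lambda>l. u l x) k)) b c)"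
proof -
  have "Ck n (hess (u l) b c)" for l
    using u[of l] b c by (simp add: hess_def[abs_def])
  then have "continuous_on UNIV (hess (u l) b c)" for l
    using Ck_imp_continuous by blast
  moreover have "continuous_on UNIV (pd (u l) b)" "continuous_on UNIV (pd (u l) c)"
    "continuous_on UNIV (u l)" for l
    using u[of l] b c by auto
  ultimately show ?thesis
    unfolding hess_ln_softmax[OF u b c, abs_def]
    by (intro continuous_intros continuous_on_softmax)
qed

section \<open>Size and Lipschitz bounds for the Hessian of the log-softmax\<close>

lemma abs_mult_diff_le:
  fixes a a' b b' :: real
  assumes "\<bar>a - a'\<bar> \<le> \<alpha>" "\<bar>b - b'\<bar> \<le> \<beta>" "\<bar>b\<bar> \<le> B" "\<bar>a'\<bar> \<le> A"
  shows "\<bar>a * b - a' * b'\<bar> \<le> \<alpha> * B + A * \<beta>"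
proof -
  have "a * b - a' * b' = (a - a') * b + a' * (b - b')"
    by (simp add: algebra_simps)
  also have "\<bar>\<dots>\<bar> \<le> \<bar>a - a'\<bar> * \<bar>b\<bar> + \<bar>a'\<bar> * \<bar>b - b'\<bar>"
    using abs_triangle_ineq[of "(a - a') * b" "a' * (b - b')"] by (simp add: abs_mult)
  also have "\<dots> \<le> \<alpha> * B + A * \<beta>"
    using assms by (intro add_mono mult_mono) auto
  finally show ?thesis .
qed

lemma abs_sum_UNIV_le:
  fixes g :: "'k::finite \<Rightarrow> real"
  assumes "\<And>l. \<bar>g l\<bar> \<le> B"
  shows "\<bar>\<Sum>l\<in>UNIV. g l\<bar> \<le> real CARD('k) * B"
  by (intro order_trans[OF sum_abs] sum_bounded_above) (rule assms)

lemma abs_sum_diff_UNIV_le: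
  fixes g h :: "'k::finite \<Rightarrow> real"
  assumes "\<And>l. \<bar>g l - h l\<bar> \<le> B"
  shows "\<bar>(\<Sum>l\<in>UNIV. g l) - (\<Sum>l\<in>UNIV. h l)\<bar> \<le> real CARD('k) * B"
  using abs_sum_UNIV_le[of "\<lambda>l. g l - h l" B] assms by (simp add: sum_subtractf)

text \<open>
  The exponents 2, 3 and 6 weight the derivatives so that each term of the differentiated Hessian
  (one third derivative, a second times a first, or three first ones) is at most \<open>w ^ 6\<close>; they match
  the moment orders 3, 2 and 1.
\<close>

lemma
  fixes u :: "'k::finite \<Rightarrow> 'a::euclidean_space \<Rightarrow> real"
  assumes u: "\<And>l. Ck 3 (u l)" and w: "w \<ge> 1"
    and bnd1: "\<And>l b x. b \<in> Basis \<Longrightarrow> x \<in> cball x0 e \<Longrightarrow> \<bar>pd (u l) b x\<bar> \<le> w ^ 2"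
    and bnd2: "\<And>l b c x. b \<in> Basis \<Longrightarrow> c \<in> Basis \<Longrightarrow> x \<in> cball x0 e \<Longrightarrow> \<bar>hess (u l) b c x\<bar> \<le> w ^ 3"
    and bnd3: "\<And>l b c d x. b \<in> Basis \<Longrightarrow> c \<in> Basis \<Longrightarrow> d \<in> Basis \<Longrightarrow> x \<in> cball x0 e \<Longrightarrow>
        \<bar>pd3 (u l) b c d x\<bar> \<le> w ^ 6"
    and b: "b \<in> Basis" and c: "c \<in> Basis" and x: "x \<in> cball x0 e"
  defines "F \<equiv> \<lambda>k x. ln (softmax (\<lambda>l. u l x) k)"
  shows hess_ln_softmax_bound: "\<bar>hess (F k) b c x\<bar> \<le> (1 + real CARD('k)) ^ 2 * w ^ 6"
    and hess_ln_softmax_lipschitz: "\<bar>hess (F k) b c x - hess (F k) b c x0\<bar> \<le>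
       real DIM('a) * (1 + 7 * real CARD('k) + 6 * real CARD('k) ^ 2) * dist x x0 * w ^ 6"
proof -
  have u': "Ck (Suc (Suc (Suc 0))) (u l)" for l
    using u[of l] by (simp add: numeral_3_eq_3)
  have x0: "x0 \<in> cball x0 e"
    using x order_trans[OF zero_le_dist] by (auto simp: mem_cball)
  let ?n = "real CARD('k)"
  define E where "E = real DIM('a) * dist x x0"
  have E: "E \<ge> 0" by (simp add: E_def)
  define p where "p z l = softmax (\<lambda>l. u l z) l" for z l
  define d where "d b' z l = pd (u l) b' z" for b' z l
  define h where "h z l = hess (u l) b c z" for z l
  define m where "m b' z = (\<Sum>l\<in>UNIV. p z l * d b' z l)" for b' z
  have hess_F: "hess (F k) b c z = h z k - (\<Sum>l\<in>UNIV. p z l * h z l)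
      - (\<Sum>l\<in>UNIV. p z l * d b z l * d c z l) + m b z * m c z" for z
    by (simp add: F_def hess_ln_softmax[OF u' b c] p_def d_def h_def m_def)
  \<comment> \<open>As \<open>w\<close> is at least 1, smaller powers can be rounded up, so all
    terms end at the common power 6.\<close>
  have pw: "w ^ i \<le> w ^ j" if "i \<le> j" for i j :: nat
    using w that by (rule power_increasing[rotated])
  have Epw: "E * w ^ i \<le> E * w ^ j" if "i \<le> j" for i j :: nat
    using pw[OF that] E by (rule mult_left_mono)
  have p1: "\<bar>p z l\<bar> \<le> 1" for z l
    using softmax_pos[of "\<lambda>l. u l z" l] softmax_le_1[of "\<lambda>l. u l z" l] by (simp add: p_def)
  have d1: "\<bar>d b' z l\<bar> \<le> w ^ 2" if "b' \<in> Basis" "z \<in> cball x0 e" for b' z l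
    using bnd1 that by (simp add: d_def)
  have h1: "\<bar>h z l\<bar> \<le> w ^ 3" if "z \<in> cball x0 e" for z l
    using bnd2 that b c by (simp add: h_def)
  have pd1: "\<bar>p z l * d b' z l\<bar> \<le> w ^ 2" if "b' \<in> Basis" "z \<in> cball x0 e" for b' z l
    using mult_mono[OF p1 d1[OF that]] by (simp add: abs_mult)
  have m1: "\<bar>m b' z\<bar> \<le> ?n * w ^ 2" if "b' \<in> Basis" "z \<in> cball x0 e" for b' z
    unfolding m_def by (intro abs_sum_UNIV_le pd1 that)
  \<comment> \<open>Each order is Lipschitz at the centre with the bound of the next order as
    constant: \<open>w ^ 2\<close> for values, \<open>w ^ 3\<close> for first and
    \<open>w ^ 6\<close> for second derivatives.\<close>
  have du: "\<bar>u l x - u l x0\<bar> \<le> E * w ^ 2" for l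
    using pd_bound_imp_lipschitz_at_centre[OF u' bnd1 x] by (simp add: E_def)
  have dd: "\<bar>d b' x l - d b' x0 l\<bar> \<le> E * w ^ 3" if b': "b' \<in> Basis" for b' l
    unfolding d_def E_def
    by (rule pd_bound_imp_lipschitz_at_centre[OF Ck_pd[OF u' b'] _ x])
       (use bnd2 b' in \<open>simp add: hess_def\<close>)
  have dh: "\<bar>h x l - h x0 l\<bar> \<le> E * w ^ 6" for l
    unfolding h_def E_def hess_def
    by (rule pd_bound_imp_lipschitz_at_centre[OF Ck_pd[OF Ck_pd[OF u' b] c] _ x])
       (use bnd3 b c in \<open>simp add: pd3_def hess_def\<close>)
  have dp: "\<bar>p x l - p x0 l\<bar> \<le> 2 * E * w ^ 2" for l
    using softmax_lipschitz[of "\<lambda>l. u l x" "\<lambda>l. u l x0", OF du] by (simp add: p_def mult.assoc)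
  have dph: "\<bar>p x l * h x l - p x0 l * h x0 l\<bar> \<le> 3 * E * w ^ 6" for l
  proof -
    have "\<bar>p x l * h x l - p x0 l * h x0 l\<bar> \<le> 2 * E * w ^ 2 * w ^ 3 + 1 * (E * w ^ 6)"
      by (rule abs_mult_diff_le[OF dp dh h1[OF x] p1])
    also have "\<dots> = 2 * (E * w ^ 5) + E * w ^ 6"
      by (simp flip: power_add)
    finally show ?thesis using Epw[of 5 6] by simp
  qed
  \<comment> \<open>Rounded up only to power 4, because below it gets multiplied by a first
    derivative or by a mean of first derivatives, which costs another \<open>w ^ 2\<close>.\<close>
  have dpd: "\<bar>p x l * d b' x l - p x0 l * d b' x0 l\<bar> \<le> 3 * E * w ^ 4" if "b' \<in> Basis" for b' l
  proof -
    have "\<bar>p x l * d b' x l - p x0 l * d b' x0 l\<bar> \<le> 2 * E * w ^ 2 * w ^ 2 + 1 * (E * w ^ 3)"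
      by (rule abs_mult_diff_le[OF dp dd[OF that] d1[OF that x] p1])
    also have "\<dots> = 2 * (E * w ^ 4) + E * w ^ 3"
      by (simp flip: power_add)
    finally show ?thesis using Epw[of 3 4] by simp
  qed
  have dm: "\<bar>m b' x - m b' x0\<bar> \<le> ?n * (3 * E * w ^ 4)" if "b' \<in> Basis" for b'
    unfolding m_def by (intro abs_sum_diff_UNIV_le dpd that)
  have dpdd: "\<bar>p x l * d b x l * d c x l - p x0 l * d b x0 l * d c x0 l\<bar> \<le> 4 * E * w ^ 6" for l
  proof -
    have "\<bar>p x l * d b x l * d c x l - p x0 l * d b x0 l * d c x0 l\<bar>
        \<le> 3 * E * w ^ 4 * w ^ 2 + w ^ 2 * (E * w ^ 3)"
      by (rule abs_mult_diff_le[OF dpd[OF b] dd[OF c] d1[OF c x] pd1[OF b x0]])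
    also have "\<dots> = 3 * (E * w ^ 6) + E * w ^ 5"
      by (simp add: mult.left_commute flip: power_add)
    finally show ?thesis using Epw[of 5 6] by simp
  qed
  have dmm: "\<bar>m b x * m c x - m b x0 * m c x0\<bar> \<le> 6 * ?n ^ 2 * E * w ^ 6"
  proof -
    have "\<bar>m b x * m c x - m b x0 * m c x0\<bar>
       \<le> ?n * (3 * E * w ^ 4) * (?n * w ^ 2) + ?n * w ^ 2 * (?n * (3 * E * w ^ 4))"
      by (rule abs_mult_diff_le[OF dm[OF b] dm[OF c] m1[OF c x] m1[OF b x0]])
    also have "\<dots> = 6 * ?n ^ 2 * E * (w ^ 4 * w ^ 2)"
      by (simp add: power2_eq_square)
    finally show ?thesis by (simp flip: power_add)
  qed
  \<comment> \<open>Origin of the constant: 1 from the second derivative of predictor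
    \<open>k\<close>, 3 and 4 per category from the two weighted sums, and 6 times the squared
    number of categories from the product of means.\<close>
  have "\<bar>hess (F k) b c x - hess (F k) b c x0\<bar> \<le> E * w ^ 6 + ?n * (3 * E * w ^ 6)
      + ?n * (4 * E * w ^ 6) + 6 * ?n ^ 2 * E * w ^ 6"
    unfolding hess_F
    using dh[of k] dmm
      abs_sum_diff_UNIV_le[of "\<lambda>l. p x l * h x l" "\<lambda>l. p x0 l * h x0 l", OF dph]
      abs_sum_diff_UNIV_le[of "\<lambda>l. p x l * d b x l * d c x l" "\<lambda>l. p x0 l * d b x0 l * d c x0 l", OF dpdd]
    by linarith
  also have "\<dots> = real DIM('a) * (1 + 7 * ?n + 6 * ?n ^ 2) * dist x x0 * w ^ 6"
    by (simp add: E_def algebra_simps)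
  finally show "\<bar>hess (F k) b c x - hess (F k) b c x0\<bar> \<le>
       real DIM('a) * (1 + 7 * ?n + 6 * ?n ^ 2) * dist x x0 * w ^ 6" .
  have ph1: "\<bar>p x l * h x l\<bar> \<le> w ^ 6" for l
    using mult_mono[OF p1 h1[OF x]] pw[of 3 6] by (simp add: abs_mult) (meson order_trans)
  have pdd1: "\<bar>p x l * d b x l * d c x l\<bar> \<le> w ^ 6" for l
  proof -
    have "\<bar>p x l * d b x l * d c x l\<bar> \<le> w ^ 2 * w ^ 2"
      using mult_mono[OF pd1[OF b x] d1[OF c x]] by (simp add: abs_mult)
    then show ?thesis using pw[of 4 6] by (simp flip: power_add)
  qed
  have mm1: "\<bar>m b x * m c x\<bar> \<le> ?n ^ 2 * w ^ 6"
  proof -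
    have "\<bar>m b x * m c x\<bar> \<le> (?n * w ^ 2) * (?n * w ^ 2)"
      using mult_mono[OF m1[OF b x] m1[OF c x]] by (simp add: abs_mult)
    also have "\<dots> = ?n ^ 2 * w ^ 4"
      by (simp add: power2_eq_square power4_eq_xxxx)
    also have "\<dots> \<le> ?n ^ 2 * w ^ 6"
      using pw[of 4 6] by (intro mult_left_mono) auto
    finally show ?thesis .
  qed
  \<comment> \<open>The four terms add up to the perfect square of 1 plus the number of
    categories.\<close>
  have "\<bar>hess (F k) b c x\<bar> \<le> w ^ 6 + ?n * w ^ 6 + ?n * w ^ 6 + ?n ^ 2 * w ^ 6"
    unfolding hess_F using h1[OF x, of k] pw[of 3 6] mm1
      abs_sum_UNIV_le[of "\<lambda>l. p x l * h x l", OF ph1]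
      abs_sum_UNIV_le[of "\<lambda>l. p x l * d b x l * d c x l", OF pdd1] by linarith
  then show "\<bar>hess (F k) b c x\<bar> \<le> (1 + ?n) ^ 2 * w ^ 6"
    by (simp add: power2_eq_square algebra_simps)
qed

subsection \<open>Convergence in probability\<close>

context prob_space
begin

text \<open>
  No measurability of \<open>Y\<close> is required: \<^const>\<open>measure\<close> vanishes on nonmeasurable sets, so covering the
  exceptional sets by events suffices.
\<close>

lemma conv_in_probI:
  assumes "\<And>e. e > 0 \<Longrightarrow> \<exists>B. (\<forall>m. B m \<in> events) \<and> (\<lambda>m. prob (B m)) \<longlonglongrightarrow> 0 \<and>
    (\<forall>\<^sub>F m in sequentially. {w \<in> space M. dist (Y m w) c > e} \<subseteq> B m)"
  shows "conv_in_prob M Y c"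
  unfolding conv_in_prob_def
proof (intro allI impI)
  fix e :: real assume "e > 0"
  from assms[OF this] obtain B where B: "\<And>m. B m \<in> events" "(\<lambda>m. prob (B m)) \<longlonglongrightarrow> 0"
    "\<forall>\<^sub>F m in sequentially. {w \<in> space M. dist (Y m w) c > e} \<subseteq> B m" by blast
  have "\<forall>\<^sub>F m in sequentially. prob {w \<in> space M. dist (Y m w) c > e} \<le> prob (B m)"
    using B(3)
  proof eventually_elim
    case (elim m)
    show ?case
      by (cases "{w \<in> space M. dist (Y m w) c > e} \<in> events")
         (use elim in \<open>auto intro: finite_measure_mono B(1) simp: measure_notin_sets\<close>)
  qed
  then show "(\<lambda>m. prob {w \<in> space M. dist (Y m w) c > e}) \<longlonglongrightarrow> 0"
    by (rule tendsto_sandwich[OF _ _ tendsto_const B(2), rotated]) simp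
qed

lemma dist_gt_in_events:
  fixes Y :: "'a \<Rightarrow> 'b::{metric_space, second_countable_topology}"
  assumes "Y \<in> borel_measurable M"
  shows "{w \<in> space M. dist (Y w) c > e} \<in> events"
  using assms by measurable

lemma conv_in_prob_linear_combination:
  fixes Y :: "'i \<Rightarrow> nat \<Rightarrow> 'a \<Rightarrow> real"
  assumes "finite I" and meas: "\<And>k m. k \<in> I \<Longrightarrow> Y k m \<in> borel_measurable M"
    and conv: "\<And>k. k \<in> I \<Longrightarrow> conv_in_prob M (Y k) (c k)"
  shows "conv_in_prob M (\<lambda>m w. \<Sum>k\<in>I. a k * Y k m w) (\<Sum>k\<in>I. a k * c k)"
proof (rule conv_in_probI)
  fix e :: real assume e: "e > 0"
  \<comment> \<open>The summand 1 keeps \<open>A\<close> positive when all coefficients vanish or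
    \<open>I\<close> is empty.\<close>
  define A where "A = (\<Sum>k\<in>I. \<bar>a k\<bar>) + 1"
  have A: "A > 0" unfolding A_def by (simp add: add_nonneg_pos sum_nonneg)
  define B where "B m = (\<Union>k\<in>I. {w \<in> space M. dist (Y k m w) (c k) > e / A})" for m
  have ev: "{w \<in> space M. dist (Y k m w) (c k) > e / A} \<in> events" if "k \<in> I" for k m
    using meas[OF that] by (rule dist_gt_in_events)
  have "(\<lambda>m. \<Sum>k\<in>I. prob {w \<in> space M. dist (Y k m w) (c k) > e / A}) \<longlonglongrightarrow> (\<Sum>k\<in>I. 0)"
    using conv e A by (intro tendsto_sum) (auto simp: conv_in_prob_def)
  moreover have "prob (B m) \<le> (\<Sum>k\<in>I. prob {w \<in> space M. dist (Y k m w) (c k) > e / A})" for m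
    unfolding B_def using ev by (intro measure_UNION_le) (auto simp: \<open>finite I\<close>)
  ultimately have "(\<lambda>m. prob (B m)) \<longlonglongrightarrow> 0"
    by (intro Lim_null_comparison[OF always_eventually, of "\<lambda>m. prob (B m)"]) simp_all
  moreover have "{w \<in> space M. dist (\<Sum>k\<in>I. a k * Y k m w) (\<Sum>k\<in>I. a k * c k) > e} \<subseteq> B m" for m
  proof clarify
    fix w assume w: "w \<in> space M" "dist (\<Sum>k\<in>I. a k * Y k m w) (\<Sum>k\<in>I. a k * c k) > e"
    show "w \<in> B m"
    proof (rule ccontr)
      assume "w \<notin> B m"
      then have le: "\<bar>Y k m w - c k\<bar> \<le> e / A" if "k \<in> I" for k
        using that w by (auto simp: B_def dist_real_def not_less)
      have "\<bar>\<Sum>k\<in>I. a k * (Y k m w - c k)\<bar> \<le> (\<Sum>k\<in>I. \<bar>a k\<bar> * (e / A))"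
        using le
        by (intro order_trans[OF sum_abs] sum_mono) (simp only: abs_mult, rule mult_left_mono, auto)
      also have "\<dots> \<le> A * (e / A)"
        unfolding sum_distrib_right[symmetric] using e A by (intro mult_right_mono) (auto simp: A_def)
      also have "A * (e / A) = e" using A by simp
      finally show False using w by (simp add: dist_real_def right_diff_distrib sum_subtractf)
    qed
  qed
  moreover have "B m \<in> events" for m
    unfolding B_def using ev \<open>finite I\<close> by (intro sets.finite_UN) auto
  ultimately show "\<exists>B. (\<forall>m. B m \<in> events) \<and> (\<lambda>m. prob (B m)) \<longlonglongrightarrow> 0 \<and>
    (\<forall>\<^sub>F m in sequentially. {w \<in> space M. dist (\<Sum>k\<in>I. a k * Y k m w) (\<Sum>k\<in>I. a k * c k) > e} \<subseteq> B m)"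
    by (intro exI[of _ B]) auto
qed

text \<open>Since \<open>V\<close> converges, it is at most \<open>\<bar>v\<bar> + 1\<close> off an
  event of vanishing probability, and multiplied by a distance tending to 0 it becomes negligible.
  The exceptional set of \<open>T\<close> is covered by one event each for \<open>A\<close>,
  \<open>V\<close> and \<open>L\<close>.\<close>

lemma conv_in_prob_of_lipschitz_bound:
  fixes T A V :: "nat \<Rightarrow> 'a \<Rightarrow> real" and L :: "nat \<Rightarrow> 'a \<Rightarrow> 'b::{metric_space, second_countable_topology}"
  assumes A: "conv_in_prob M A a" "\<And>m. A m \<in> borel_measurable M"
    and V: "conv_in_prob M V v" "\<And>m. V m \<in> borel_measurable M"
    and L: "conv_in_prob M L l" "\<And>m. L m \<in> borel_measurable M"
    and "e0 > 0" "C \<ge> 0"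
    and bnd: "\<And>m w. w \<in> space M \<Longrightarrow> dist (L m w) l \<le> e0 \<Longrightarrow> \<bar>T m w - A m w\<bar> \<le> C * dist (L m w) l * V m w"
  shows "conv_in_prob M T a"
proof (rule conv_in_probI)
  fix e :: real assume e: "e > 0"
  define D where "D = C * (\<bar>v\<bar> + 1) + 1"
  have D: "D > 0" unfolding D_def using \<open>C \<ge> 0\<close> by (simp add: add_nonneg_pos)
  \<comment> \<open>Within \<open>e0\<close> the Lipschitz bound applies; within
    \<open>e / 2 / D\<close> its right-hand side is at most \<open>e / 2\<close>.\<close>
  define \<delta> where "\<delta> = min e0 (e / 2 / D)"
  have \<delta>: "\<delta> > 0" "\<delta> \<le> e0" "\<delta> \<le> e / 2 / D"
    using e D \<open>e0 > 0\<close> by (auto simp: \<delta>_def)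
  define B1 where "B1 m = {w \<in> space M. dist (A m w) a > e / 2}" for m
  define B2 where "B2 m = {w \<in> space M. dist (V m w) v > 1}" for m
  define B3 where "B3 m = {w \<in> space M. dist (L m w) l > \<delta>}" for m
  have ev: "B1 m \<in> events" "B2 m \<in> events" "B3 m \<in> events" for m
    unfolding B1_def B2_def B3_def using A V L by (auto intro: dist_gt_in_events)
  have "(\<lambda>m. prob (B1 m) + prob (B2 m) + prob (B3 m)) \<longlonglongrightarrow> 0 + 0 + 0"
    using A(1)[unfolded conv_in_prob_def, rule_format, of "e / 2"] e
      V(1)[unfolded conv_in_prob_def, rule_format, of 1]
      L(1)[unfolded conv_in_prob_def, rule_format, of \<delta>] \<delta>(1)
    unfolding B1_def B2_def B3_def by (intro tendsto_add) simp_all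
  moreover have "prob (B1 m \<union> B2 m \<union> B3 m) \<le> prob (B1 m) + prob (B2 m) + prob (B3 m)" for m
    using measure_Un_le[OF sets.Un[OF ev(1,2)] ev(3), of m m m] measure_Un_le[OF ev(1,2), of m m] by linarith
  ultimately have "(\<lambda>m. prob (B1 m \<union> B2 m \<union> B3 m)) \<longlonglongrightarrow> 0"
    by (intro Lim_null_comparison[OF always_eventually, of "\<lambda>m. prob (B1 m \<union> B2 m \<union> B3 m)"]) simp_all
  moreover have "{w \<in> space M. dist (T m w) a > e} \<subseteq> B1 m \<union> B2 m \<union> B3 m" for m
  proof
    fix w assume "w \<in> {w \<in> space M. dist (T m w) a > e}"
    then have w: "w \<in> space M" "dist (T m w) a > e" by auto
    show "w \<in> B1 m \<union> B2 m \<union> B3 m"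
    proof (rule ccontr)
      assume "w \<notin> B1 m \<union> B2 m \<union> B3 m"
      then have a: "\<bar>A m w - a\<bar> \<le> e / 2" and v: "\<bar>V m w - v\<bar> \<le> 1" and l: "dist (L m w) l \<le> \<delta>"
        using w by (auto simp: B1_def B2_def B3_def dist_real_def)
      have "C * dist (L m w) l * V m w \<le> C * \<delta> * (\<bar>v\<bar> + 1)"
      proof -
        have "V m w \<le> \<bar>v\<bar> + 1" using v by linarith
        then have "C * dist (L m w) l * V m w \<le> C * dist (L m w) l * (\<bar>v\<bar> + 1)"
          using \<open>C \<ge> 0\<close> by (intro mult_left_mono) auto
        also have "\<dots> \<le> C * \<delta> * (\<bar>v\<bar> + 1)"
          using \<open>C \<ge> 0\<close> l by (intro mult_right_mono mult_left_mono) auto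
        finally show ?thesis .
      qed
      also have "\<dots> \<le> D * \<delta>"
        using \<delta> by (simp add: D_def algebra_simps)
      also have "\<dots> \<le> e / 2"
        using \<delta>(3) D by (simp add: field_simps)
      finally have "\<bar>T m w - A m w\<bar> \<le> e / 2"
        using bnd[of w m] w l \<delta> by linarith
      then show False using a w(2) unfolding dist_real_def by linarith
    qed
  qed
  ultimately show "\<exists>B. (\<forall>m. B m \<in> events) \<and> (\<lambda>m. prob (B m)) \<longlonglongrightarrow> 0 \<and>
    (\<forall>\<^sub>F m in sequentially. {w \<in> space M. dist (T m w) a > e} \<subseteq> B m)"
    using ev by (intro exI[of _ "\<lambda>m. B1 m \<union> B2 m \<union> B3 m"]) auto
qed

text \<open>
  Truncation at a fixed level makes the variables bounded, so that Hoeffding's inequality applies; the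
  discarded part is small in the mean, uniformly in \<open>n\<close>, and is handled by Markov's inequality.
\<close>

lemma weak_law_of_large_numbers:
  fixes Y :: "'i \<Rightarrow> 'a \<Rightarrow> real"
  assumes indep: "indep_vars (\<lambda>_. borel) Y J"
    and distr_Y: "\<And>i. i \<in> J \<Longrightarrow> distr M borel (Y i) = distr M borel Z"
    and Z: "integrable M Z"
    and I: "\<And>n. finite (I n)" "\<And>n. I n \<subseteq> J" "filterlim (\<lambda>n. card (I n)) at_top sequentially"
  shows "conv_in_prob M (\<lambda>n w. (\<Sum>i\<in>I n. Y i w) / real (card (I n))) (expectation Z)"
proof (rule conv_in_probI)
  fix e :: real assume e: "e > 0"
  have Y_meas [measurable]: "Y i \<in> borel_measurable M" if "i \<in> J" for i
    using indep that by (auto simp: indep_vars_def)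
  have Z_meas [measurable]: "Z \<in> borel_measurable M" using Z by auto
  define S where "S n w = (\<Sum>i\<in>I n. Y i w) / real (card (I n))" for n w
  have S_meas [measurable]: "S n \<in> borel_measurable M" for n
    unfolding S_def using I(2) by (auto intro!: borel_measurable_divide borel_measurable_sum Y_meas)
  have "(\<lambda>n. prob {w \<in> space M. dist (S n w) (expectation Z) > e}) \<longlonglongrightarrow> 0"
  proof (rule LIMSEQ_I)
    fix \<eta> :: real assume \<eta>: "\<eta> > 0"
    define t where "t j y = (if \<bar>y\<bar> \<le> real j then y else 0)" for j :: nat and y :: real
    have t_meas [measurable]: "t j \<in> borel_measurable borel" for j
      unfolding t_def by measurable
    define \<rho> where "\<rho> j = expectation (\<lambda>w. \<bar>Z w - t j (Z w)\<bar>)" for j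
    have "\<rho> \<longlonglongrightarrow> expectation (\<lambda>w. 0)"
      unfolding \<rho>_def
    proof (rule integral_dominated_convergence[where w = "\<lambda>w. \<bar>Z w\<bar>"])
      show "AE w in M. (\<lambda>j. \<bar>Z w - t j (Z w)\<bar>) \<longlonglongrightarrow> 0"
      proof (rule AE_I2)
        fix w
        obtain j0 :: nat where "\<bar>Z w\<bar> \<le> real j0" using real_arch_simple by blast
        then have "\<bar>Z w - t j (Z w)\<bar> = 0" if "j \<ge> j0" for j
          using that by (auto simp: t_def)
        then show "(\<lambda>j. \<bar>Z w - t j (Z w)\<bar>) \<longlonglongrightarrow> 0"
          by (intro tendsto_eventually eventually_sequentiallyI[of j0])
      qed
    qed (use Z in \<open>auto simp: t_def\<close>)
    then have "\<rho> \<longlonglongrightarrow> 0" by simp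
    \<comment> \<open>The first bound controls the bias of the truncated mean, the second makes the
      Markov estimate of the remainder smaller than \<open>\<eta> / 2\<close>. Below,
      \<open>j\<close> is also taken positive, so that the range \<open>[-c, c]\<close> is
      nondegenerate.\<close>
    then have "\<forall>\<^sub>F j in sequentially. \<rho> j < min (e / 3) (e / 3 * (\<eta> / 2))"
      by (rule order_tendstoD) (use e \<eta> in auto)
    from eventually_happens'[OF sequentially_bot eventually_conj[OF this eventually_gt_at_top[of 0]]]
    obtain j where j: "j > 0" "\<rho> j < e / 3" "\<rho> j < e / 3 * (\<eta> / 2)"
      by auto
    define c where "c = real j"
    have c: "c > 0" using j by (simp add: c_def)
    \<comment> \<open>Hoeffding exponent per observation, for a deviation of \<open>e / 3\<close> of
      variables with values in \<open>[-c, c]\<close>.\<close>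
    define q where "q = 2 * (e / 3)\<^sup>2 / (c - (- c))\<^sup>2"
    have "q > 0" using e c by (simp add: q_def)
    have tc: "\<bar>t j y\<bar> \<le> c" for y by (auto simp: t_def c_def)
    have int_t: "integrable M (\<lambda>w. t j (X w))" if "X \<in> borel_measurable M" for X
      using that tc by (intro integrable_const_bound[of _ c]) auto
    have transfer: "integrable M (\<lambda>w. g (Y i w)) = integrable M (\<lambda>w. g (Z w))"
        "expectation (\<lambda>w. g (Y i w)) = expectation (\<lambda>w. g (Z w))"
      if "i \<in> J" "g \<in> borel_measurable borel" for i and g :: "real \<Rightarrow> real"
      using distr_Y[OF that(1)] that
        integrable_distr_eq[of "Y i" M borel g] integrable_distr_eq[of Z M borel g]
        integral_distr[of "Y i" M borel g] integral_distr[of Z M borel g] by auto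
    have int_r: "integrable M (\<lambda>w. \<bar>Z w - t j (Z w)\<bar>)"
      using Z int_t by auto
    have "\<bar>expectation (\<lambda>w. t j (Z w)) - expectation Z\<bar> = \<bar>expectation (\<lambda>w. Z w - t j (Z w))\<bar>"
      using Z int_t by (simp add: Bochner_Integration.integral_diff)
    also have "\<dots> \<le> \<rho> j" unfolding \<rho>_def by (rule integral_abs_bound)
    finally have mean: "\<bar>expectation (\<lambda>w. t j (Z w)) - expectation Z\<bar> < e / 3"
      using j by simp
    define St where "St n w = (\<Sum>i\<in>I n. t j (Y i w)) / real (card (I n))" for n w
    define R where "R n w = (\<Sum>i\<in>I n. \<bar>Y i w - t j (Y i w)\<bar>) / real (card (I n))" for n w
    define B1 where "B1 n = {w \<in> space M. \<bar>St n w - expectation (\<lambda>w. t j (Z w))\<bar> \<ge> e / 3}" for n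
    define B2 where "B2 n = {w \<in> space M. R n w \<ge> e / 3}" for n
    have St_meas [measurable]: "St n \<in> borel_measurable M" for n
      unfolding St_def using I(2)
      by (auto intro!: borel_measurable_divide borel_measurable_sum measurable_compose[OF Y_meas t_meas])
    have R_meas [measurable]: "R n \<in> borel_measurable M" for n
      unfolding R_def using I(2)
      by (auto intro!: borel_measurable_divide borel_measurable_sum borel_measurable_abs
           borel_measurable_diff measurable_compose[OF Y_meas t_meas] Y_meas)
    have B1: "prob (B1 n) \<le> 2 * exp (- (real (card (I n)) * q))" if "I n \<noteq> {}" for n
    proof -
      have dt: "distr M borel (\<lambda>w. t j (Y i w)) = distr M borel (\<lambda>w. t j (Z w))" if "i \<in> J" for i
        using distr_distr[of "t j" borel borel "Y i" M] distr_distr[of "t j" borel borel Z M]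
          distr_Y[OF that] that by (simp add: comp_def)
      interpret H: Hoeffding_ineq_iid M "I n" "\<lambda>i w. t j (Y i w)" "\<lambda>w. t j (Z w)" "- c" c
        "expectation (\<lambda>w. t j (Z w))"
      proof unfold_locales
        show "indep_vars (\<lambda>_. borel) (\<lambda>i w. t j (Y i w)) (I n)"
          by (rule indep_vars_compose2[OF indep_vars_subset[OF indep I(2)]]) simp
        show "AE w in M. t j (Z w) \<in> {- c..c}"
          using tc by (auto simp: abs_le_iff minus_le_iff)
      qed (use I(1,2) dt in auto)
      show ?thesis
        using H.Hoeffding_ineq_abs_ge'[of "e / 3"] e c that by (simp add: B1_def St_def q_def mult.commute)
    qed
    have "((\<lambda>N::nat. 2 * exp (- (real N * q))) \<longlongrightarrow> 0) at_top"
      using \<open>q > 0\<close> by real_asymp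
    then have "(\<lambda>n. 2 * exp (- (real (card (I n)) * q))) \<longlonglongrightarrow> 0"
      using I(3) by (rule filterlim_compose)
    then have "\<forall>\<^sub>F n in sequentially. 2 * exp (- (real (card (I n)) * q)) < \<eta> / 2"
      by (rule order_tendstoD) (use \<eta> in auto)
    moreover have "\<forall>\<^sub>F n in sequentially. card (I n) > 0"
      using I(3)[unfolded filterlim_at_top, rule_format, of 1] by eventually_elim simp
    ultimately have "\<forall>\<^sub>F n in sequentially. prob {w \<in> space M. dist (S n w) (expectation Z) > e} < \<eta>"
    proof eventually_elim
      case (elim n)
      then have ne: "I n \<noteq> {}" by auto
      have "expectation (R n) = (\<Sum>i\<in>I n. expectation (\<lambda>w. \<bar>Y i w - t j (Y i w)\<bar>)) / real (card (I n))"
        unfolding R_def using I(2) transfer(1)[of _ "\<lambda>y. \<bar>y - t j y\<bar>"] int_r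
        by (subst integral_divide_zero, subst Bochner_Integration.integral_sum) auto
      also have "(\<Sum>i\<in>I n. expectation (\<lambda>w. \<bar>Y i w - t j (Y i w)\<bar>)) = (\<Sum>i\<in>I n. \<rho> j)"
        unfolding \<rho>_def using I(2) by (intro sum.cong refl transfer(2)[of _ "\<lambda>y. \<bar>y - t j y\<bar>"]) auto
      finally have ER: "expectation (R n) = \<rho> j" using elim by simp
      have int_R: "integrable M (R n)"
        unfolding R_def using I(2) transfer(1)[of _ "\<lambda>y. \<bar>y - t j y\<bar>"] int_r
        by (intro integrable_divide_zero Bochner_Integration.integrable_sum) auto
      have "prob (B2 n) \<le> expectation (R n) / (e / 3)"
        unfolding B2_def using e
        by (intro integral_Markov_inequality_measure[OF int_R, of "space M"])
           (auto simp: R_def intro!: divide_nonneg_nonneg sum_nonneg)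
      also have "\<dots> < \<eta> / 2" using j(3) e by (simp add: ER field_simps)
      finally have 2: "prob (B2 n) < \<eta> / 2" .
      \<comment> \<open>The deviation is split into thirds: truncation remainder, fluctuation of the
        truncated mean, and its bias.\<close>
      have "{w \<in> space M. dist (S n w) (expectation Z) > e} \<subseteq> B1 n \<union> B2 n"
      proof clarify
        fix w assume w: "w \<in> space M" "dist (S n w) (expectation Z) > e" "w \<notin> B2 n"
        have "S n w - St n w = (\<Sum>i\<in>I n. Y i w - t j (Y i w)) / real (card (I n))"
          by (simp add: S_def St_def sum_subtractf diff_divide_distrib)
        also have "\<bar>\<dots>\<bar> \<le> R n w"
          unfolding R_def abs_divide by (simp add: divide_right_mono sum_abs)
        finally have "\<bar>S n w - St n w\<bar> < e / 3" using w by (auto simp: B2_def)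
        then have "\<bar>St n w - expectation (\<lambda>w. t j (Z w))\<bar> \<ge> e / 3"
          using w(2) mean unfolding dist_real_def by linarith
        then show "w \<in> B1 n" using w(1) by (simp add: B1_def)
      qed
      then have "prob {w \<in> space M. dist (S n w) (expectation Z) > e} \<le> prob (B1 n \<union> B2 n)"
        by (intro finite_measure_mono) (auto simp: B1_def B2_def)
      also have "\<dots> \<le> prob (B1 n) + prob (B2 n)"
        by (intro measure_Un_le) (auto simp: B1_def B2_def)
      also have "\<dots> < \<eta>" using B1[OF ne] elim 2 by linarith
      finally show ?case .
    qed
    then show "\<exists>n0. \<forall>n\<ge>n0. norm (prob {w \<in> space M. dist (S n w) (expectation Z) > e} - 0) < \<eta>"
      by (simp add: eventually_sequentially)
  qed
  then show "\<exists>B. (\<forall>m. B m \<in> events) \<and> (\<lambda>m. prob (B m)) \<longlonglongrightarrow> 0 \<and>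
    (\<forall>\<^sub>F m in sequentially. {w \<in> space M. dist ((\<Sum>i\<in>I m. Y i w) / real (card (I m))) (expectation Z) > e} \<subseteq> B m)"
    by (intro exI[of _ "\<lambda>m. {w \<in> space M. dist (S m w) (expectation Z) > e}"])
       (auto simp: S_def[symmetric] intro!: dist_gt_in_events)
qed

end

text \<open>Each stratum is an i.i.d. slice of the jointly independent array and obeys the weak law
  on its own; a fixed linear combination of the limits then joins the strata.\<close>

lemma (in prob_space) conv_in_prob_stratified_mean:
  fixes X :: "'k::finite \<Rightarrow> nat \<Rightarrow> 'a \<Rightarrow> 'x" and g :: "'k \<Rightarrow> 'x \<Rightarrow> real"
  assumes indep: "indep_vars (\<lambda>_. nu) (\<lambda>(k, i). X k i) UNIV"
    and X: "\<And>k i. X k i \<in> measurable M nu" "\<And>k i. distr M nu (X k i) = P k"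
    and g: "\<And>k. g k \<in> borel_measurable nu" "\<And>k. integrable (P k) (g k)"
    and ns: "\<And>k. filterlim (\<lambda>m. ns m k) at_top sequentially"
  shows "conv_in_prob M (\<lambda>m w. \<Sum>k\<in>UNIV. r k * ((\<Sum>i<ns m k. g k (X k i w)) / real (ns m k)))
    (\<Sum>k\<in>UNIV. r k * integral\<^sup>L (P k) (g k))"
proof (rule conv_in_prob_linear_combination)
  fix k :: 'k
  show "(\<lambda>w. (\<Sum>i<ns m k. g k (X k i w)) / real (ns m k)) \<in> borel_measurable M" for m
    by (intro borel_measurable_divide borel_measurable_sum measurable_compose[OF X(1) g(1)]) auto
  let ?Y = "\<lambda>p w. g k ((case p of (k, i) \<Rightarrow> X k i) w)"
  \<comment> \<open>The stratum becomes the set of index pairs with first component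
    \<open>k\<close>; its first observation serves as representative of the common law.\<close>
  have "conv_in_prob M (\<lambda>m w. (\<Sum>p\<in>Pair k ` {..<ns m k}. ?Y p w) / real (card (Pair k ` {..<ns m k})))
      (expectation (\<lambda>w. g k (X k 0 w)))"
  proof (rule weak_law_of_large_numbers[where J = "range (Pair k)"])
    show "indep_vars (\<lambda>_. borel) ?Y (range (Pair k))"
      by (rule indep_vars_compose2[OF indep_vars_subset[OF indep]]) (auto simp: g)
    show "integrable M (\<lambda>w. g k (X k 0 w))"
      using g(2)[of k] unfolding X(2)[of k 0, symmetric] by (subst (asm) integrable_distr_eq) (auto simp: g X)
    have "distr M borel (\<lambda>w. g k (X k i w)) = distr (P k) borel (g k)" for i
      using distr_distr[OF g(1)[of k] X(1)[of k i]] by (simp add: X comp_def)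
    then show "distr M borel (?Y p) = distr M borel (\<lambda>w. g k (X k 0 w))" if "p \<in> range (Pair k)" for p
      using that by auto
    show "filterlim (\<lambda>m. card (Pair k ` {..<ns m k})) at_top sequentially"
      using ns[of k] by (simp add: card_image inj_on_def)
  qed auto
  moreover have "expectation (\<lambda>w. g k (X k 0 w)) = integral\<^sup>L (P k) (g k)"
    unfolding X(2)[of k 0, symmetric] by (rule integral_distr[symmetric]) (auto simp: g X)
  ultimately show "conv_in_prob M (\<lambda>m w. (\<Sum>i<ns m k. g k (X k i w)) / real (ns m k)) (integral\<^sup>L (P k) (g k))"
    by (simp add: card_image inj_on_def sum.reindex)
qed auto

subsection \<open>Measurable envelopes\<close>

text \<open>Applied with a countable \<open>T\<close>: a supremum over uncountably many parameters
  becomes a countable one, whose measurability in \<open>x\<close> follows from that of each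
  member.\<close>

lemma SUP_ennreal_dense:
  fixes h :: "'a::metric_space \<Rightarrow> real"
  assumes h: "continuous_on S h" and T: "T \<subseteq> S" "S \<subseteq> closure T"
  shows "(\<Squnion>\<theta>\<in>S. ennreal (h \<theta>)) = (\<Squnion>\<theta>\<in>T. ennreal (h \<theta>))"
proof (rule antisym)
  show "(\<Squnion>\<theta>\<in>S. ennreal (h \<theta>)) \<le> (\<Squnion>\<theta>\<in>T. ennreal (h \<theta>))"
  proof (rule SUP_least)
    fix \<theta> assume \<theta>: "\<theta> \<in> S"
    then obtain s where s: "\<And>n. s n \<in> T" "s \<longlonglongrightarrow> \<theta>"
      using T(2) closure_sequential[of \<theta> T] by blast
    have "(\<lambda>n. h (s n)) \<longlonglongrightarrow> h \<theta>"
      using h \<theta> s T(1) by (auto simp: continuous_on_sequentially comp_def)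
    then have "(\<lambda>n. ennreal (h (s n))) \<longlonglongrightarrow> ennreal (h \<theta>)"
      by (rule tendsto_ennrealI)
    then show "ennreal (h \<theta>) \<le> (\<Squnion>\<theta>\<in>T. ennreal (h \<theta>))"
      by (rule LIMSEQ_le_const2) (auto intro!: SUP_upper s(1))
  qed
qed (use T in \<open>auto intro!: SUP_subset_mono\<close>)

text \<open>The envelope is the pointwise supremum itself, so one function serves all measures
  \<open>P k\<close>. Compactness makes it finite at every point, not only almost everywhere, so
  passing to reals loses nothing.\<close>

lemma integrable_envelope:
  fixes h :: "'x \<Rightarrow> 'a::{metric_space, second_countable_topology} \<Rightarrow> real"
  assumes h_cont: "\<And>x. x \<in> space N \<Longrightarrow> continuous_on S (h x)"
    and h_meas: "\<And>\<theta>. \<theta> \<in> S \<Longrightarrow> (\<lambda>x. h x \<theta>) \<in> borel_measurable N"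
    and S: "compact S"
    and P: "\<And>k. sets (P k) = sets N" "\<And>k. (\<integral>\<^sup>+x. (\<Squnion>\<theta>\<in>S. ennreal (h x \<theta>)) \<partial>P k) < \<infinity>"
  shows "\<exists>W. (\<forall>x. 0 \<le> W x) \<and> W \<in> borel_measurable N \<and> (\<forall>k. integrable (P k) W) \<and>
    (\<forall>x\<in>space N. \<forall>\<theta>\<in>S. h x \<theta> \<le> W x)"
proof -
  define s where "s x = (\<Squnion>\<theta>\<in>S. ennreal (h x \<theta>))" for x
  obtain T where T: "countable T" "T \<subseteq> S" "S \<subseteq> closure T"
    using separable[of S] .
  have "(\<lambda>x. \<Squnion>\<theta>\<in>T. ennreal (h x \<theta>)) \<in> borel_measurable N"
    using T h_meas by (intro borel_measurable_SUP) (auto intro!: measurable_compose[OF _ measurable_ennreal])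
  moreover have "s x = (\<Squnion>\<theta>\<in>T. ennreal (h x \<theta>))" if "x \<in> space N" for x
    unfolding s_def by (rule SUP_ennreal_dense[OF h_cont[OF that] T(2,3)])
  ultimately have s_meas: "s \<in> borel_measurable N"
    by (simp cong: measurable_cong)
  have s_fin: "s x < \<infinity>" if "x \<in> space N" for x
  proof -
    have "bounded (h x ` S)"
      by (intro compact_imp_bounded compact_continuous_image h_cont that S)
    then obtain B where "\<And>\<theta>. \<theta> \<in> S \<Longrightarrow> \<bar>h x \<theta>\<bar> \<le> B"
      by (auto simp: bounded_iff)
    then have "s x \<le> ennreal B"
      unfolding s_def by (intro SUP_least ennreal_leI) force
    then show ?thesis by (simp add: order_le_less_trans)
  qed
  have "integrable (P k) (\<lambda>x. enn2real (s x))" for k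
  proof (rule integrableI_nonneg)
    show "(\<lambda>x. enn2real (s x)) \<in> borel_measurable (P k)"
      using s_meas by (subst measurable_cong_sets[OF P(1) refl]) measurable
    have "(\<integral>\<^sup>+x. ennreal (enn2real (s x)) \<partial>P k) \<le> (\<integral>\<^sup>+x. s x \<partial>P k)"
      by (intro nn_integral_mono) (simp add: ennreal_enn2real_if)
    then show "(\<integral>\<^sup>+x. ennreal (enn2real (s x)) \<partial>P k) < \<infinity>"
      using P(2)[of k] by (simp add: s_def order_le_less_trans)
  qed auto
  moreover have "h x \<theta> \<le> enn2real (s x)" if "x \<in> space N" "\<theta> \<in> S" for x \<theta>
  proof -
    have "ennreal (h x \<theta>) \<le> s x"
      unfolding s_def using that by (intro SUP_upper)
    also have "\<dots> = ennreal (enn2real (s x))"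
      using s_fin[OF that(1)] by simp
    finally show ?thesis by (simp add: ennreal_le_iff)
  qed
  ultimately show ?thesis
    using s_meas by (intro exI[of _ "\<lambda>x. enn2real (s x)"]) auto
qed

lemma integrable_envelope_family:
  fixes h :: "'i \<Rightarrow> 'x \<Rightarrow> 'a::{metric_space, second_countable_topology} \<Rightarrow> real"
  assumes I: "finite I"
    and h_cont: "\<And>i x. i \<in> I \<Longrightarrow> x \<in> space N \<Longrightarrow> continuous_on S (h i x)"
    and h_meas: "\<And>i \<theta>. i \<in> I \<Longrightarrow> \<theta> \<in> S \<Longrightarrow> (\<lambda>x. h i x \<theta>) \<in> borel_measurable N"
    and S: "compact S"
    and P: "\<And>k. sets (P k) = sets N" "\<And>i k. i \<in> I \<Longrightarrow> (\<integral>\<^sup>+x. (\<Squnion>\<theta>\<in>S. ennreal (h i x \<theta>)) \<partial>P k) < \<infinity>"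
  shows "\<exists>W. (\<forall>x. 0 \<le> W x) \<and> W \<in> borel_measurable N \<and> (\<forall>k. integrable (P k) W) \<and>
    (\<forall>i\<in>I. \<forall>x\<in>space N. \<forall>\<theta>\<in>S. h i x \<theta> \<le> W x)"
proof -
  have "\<forall>i\<in>I. \<exists>W. (\<forall>x. 0 \<le> W x) \<and> W \<in> borel_measurable N \<and> (\<forall>k. integrable (P k) W) \<and>
    (\<forall>x\<in>space N. \<forall>\<theta>\<in>S. h i x \<theta> \<le> W x)"
    using assms by (intro ballI integrable_envelope) auto
  then obtain W where W: "\<And>i x. i \<in> I \<Longrightarrow> 0 \<le> W i x" "\<And>i. i \<in> I \<Longrightarrow> W i \<in> borel_measurable N"
    "\<And>i k. i \<in> I \<Longrightarrow> integrable (P k) (W i)"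
    "\<And>i x \<theta>. i \<in> I \<Longrightarrow> x \<in> space N \<Longrightarrow> \<theta> \<in> S \<Longrightarrow> h i x \<theta> \<le> W i x"
    unfolding bchoice_iff by blast
  have "h i x \<theta> \<le> (\<Sum>i\<in>I. W i x)" if "i \<in> I" "x \<in> space N" "\<theta> \<in> S" for i x \<theta>
    using W(4)[OF that] member_le_sum[OF that(1), of "\<lambda>i. W i x"] W(1) I by fastforce
  then show ?thesis
    using W by (intro exI[of _ "\<lambda>x. \<Sum>i\<in>I. W i x"])
      (auto intro!: sum_nonneg borel_measurable_sum Bochner_Integration.integrable_sum)
qed

subsection \<open>The retrospective likelihood\<close>

lemma abs_integral_unit_diff_le:
  fixes \<phi> :: "real \<Rightarrow> real"
  assumes "continuous_on {0..1} \<phi>" and "\<And>t. t \<in> {0..1} \<Longrightarrow> \<bar>\<phi> t - a\<bar> \<le> B"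
  shows "\<bar>integral {0..1} \<phi> - a\<bar> \<le> B"
proof -
  have int: "\<phi> integrable_on {0..1}"
    using assms(1) by (rule integrable_continuous_interval)
  have "integral {0..1} \<phi> - a = integral {0..1} (\<lambda>t. \<phi> t - a)"
    using int by (subst integral_diff) auto
  moreover have "norm (integral {0..1} (\<lambda>t. \<phi> t - a)) \<le> B * (1 - 0)"
    using assms by (intro integral_bound) (auto intro!: continuous_intros)
  ultimately show ?thesis by simp
qed

section \<open>The linear predictor as a function of the joint parameter\<close>

lemma gam_add_scaleR: "gam (lam + t *\<^sub>R b) k = gam lam k + t * gam b k"
  by (auto simp: gam_def split: option.split)

lemma continuous_on_gam: "continuous_on S (\<lambda>lam. gam lam k)"
  by (cases k) (auto simp: gam_def intro!: continuous_intros)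

lemma abs_gam_Basis_le:
  assumes "b \<in> Basis"
  shows "\<bar>gam b k\<bar> \<le> 1"
proof (cases k)
  case (Some j)
  have "\<bar>snd b $ j\<bar> \<le> norm b"
    using component_le_norm_cart[of "snd b" j] norm_snd_le[of "snd b" "fst b"] by simp
  then show ?thesis using Some assms by (simp add: gam_def)
qed (simp add: gam_def)

context
  fixes G :: "'k::finite option \<Rightarrow> real^'s \<Rightarrow> real"
  assumes G: "\<And>k. Ck 3 (G k)"
begin

lemma Ck3_linear_predictor:
  "Ck 3 (\<lambda>lam :: (real^'s) \<times> (real^'k). gam lam k + G k (fst lam))"
  by (intro Ck_add Ck_fst G Ck_linear_of_pd_const(1) continuous_on_gam gam_add_scaleR)

lemma pd_linear_predictor:
  fixes b :: "(real^'s) \<times> (real^'k)"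
  assumes "b \<in> Basis"
  shows "pd (\<lambda>lam. gam lam k + G k (fst lam)) b = (\<lambda>lam. gam b k + pd (G k) (fst b) (fst lam))"
proof -
  have "Ck (Suc 2) (\<lambda>lam :: (real^'s) \<times> (real^'k). G k (fst lam))"
    "Ck (Suc 2) (\<lambda>lam :: (real^'s) \<times> (real^'k). gam lam k)"
    using Ck_fst[OF G[of k]] Ck_linear_of_pd_const(1)[where k = 3, OF continuous_on_gam gam_add_scaleR]
    by (simp_all add: eval_nat_numeral del: Ck.simps)
  from pd_add[OF this(2,1) assms] show ?thesis
    by (simp add: pd_fst Ck_linear_of_pd_const(2)[OF continuous_on_gam gam_add_scaleR assms])
qed

text \<open>The intercept is linear, so its first derivative is a constant that disappears here:
  from second order on only the log-odds part contributes.\<close>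

lemma hess_linear_predictor:
  fixes b c :: "(real^'s) \<times> (real^'k)"
  assumes "b \<in> Basis"
  shows "hess (\<lambda>lam. gam lam k + G k (fst lam)) b c = (\<lambda>lam. hess (G k) (fst b) (fst c) (fst lam))"
  by (rule ext) (simp add: hess_def pd_linear_predictor[OF assms] pd_const_add pd_fst)

lemma pd3_linear_predictor:
  fixes b c d :: "(real^'s) \<times> (real^'k)"
  assumes "b \<in> Basis"
  shows "pd3 (\<lambda>lam. gam lam k + G k (fst lam)) b c d = (\<lambda>lam. pd3 (G k) (fst b) (fst c) (fst d) (fst lam))"
  by (rule ext) (simp add: pd3_def hess_linear_predictor[OF assms] pd_fst)

end

text \<open>Separates the directions of \<theta> from those of the intercepts, along which every
  derivative of the log-odds part is 0.\<close>

lemma fst_Basis_cases: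
  fixes b :: "'a::euclidean_space \<times> 'b::euclidean_space"
  assumes "b \<in> Basis"
  obtains "fst b \<in> Basis" "snd b = 0" | "fst b = 0"
  using assms by (auto simp: Basis_prod_def)

lemma pd_zero_dir [simp]: "pd F 0 x = 0" "hess F 0 c x = 0" "hess F b 0 x = 0"
  "pd3 F 0 c d x = 0" "pd3 F b 0 d x = 0" "pd3 F b c 0 x = 0"
  by (simp_all add: pd_zero hess_def pd3_def pd_const)

lemma gam_snd_zero: "snd b = 0 \<Longrightarrow> gam b k = 0"
  by (cases k) (auto simp: gam_def)

text \<open>Continuity in \<open>z\<close> is known only on the range of \<open>h\<close>, which may
  fail to be a Borel set; hence the detour through the trace of the Borel sets on that
  range.\<close>

lemma measurable_slice:
  assumes "continuous_on (h ` space N \<times> V) (\<lambda>(z, v). F z v)" and "h \<in> borel_measurable N" and "v \<in> V"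
  shows "(\<lambda>x. F (h x) v) \<in> borel_measurable N"
proof -
  have "continuous_on (h ` space N) (\<lambda>z. (\<lambda>(z, v). F z v) (z, v))"
    by (rule continuous_on_compose2[OF assms(1)]) (use assms(3) in \<open>auto intro!: continuous_intros\<close>)
  then have "(\<lambda>z. F z v) \<in> borel_measurable (restrict_space borel (h ` space N))"
    by (intro borel_measurable_continuous_on_restrict) simp
  moreover have "h \<in> measurable N (restrict_space borel (h ` space N))"
    using assms(2) by (intro measurable_restrict_space2) auto
  ultimately show ?thesis
    by (rule measurable_compose[rotated])
qed

text \<open>Transfers bounds in \<theta> to the joint parameter. The projection to \<theta> does not
  increase distances, so the ball keeps its radius; an intercept direction contributes a first
  derivative of size at most 1, which \<open>w \<ge> 1\<close> absorbs.\<close>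

lemma
  fixes G :: "'k::finite option \<Rightarrow> real^'s \<Rightarrow> real" and lam lam0 :: "(real^'s) \<times> (real^'k)"
  assumes G: "\<And>k. Ck 3 (G k)" and w: "w \<ge> 1"
    and bnd1: "\<And>l a \<theta>. a \<in> Basis \<Longrightarrow> \<theta> \<in> cball (fst lam0) e \<Longrightarrow> \<bar>pd (G l) a \<theta>\<bar> \<le> w ^ 2"
    and bnd2: "\<And>l a b \<theta>. a \<in> Basis \<Longrightarrow> b \<in> Basis \<Longrightarrow> \<theta> \<in> cball (fst lam0) e \<Longrightarrow>
        \<bar>hess (G l) a b \<theta>\<bar> \<le> w ^ 3"
    and bnd3: "\<And>l a b c \<theta>. a \<in> Basis \<Longrightarrow> b \<in> Basis \<Longrightarrow> c \<in> Basis \<Longrightarrow> \<theta> \<in> cball (fst lam0) e \<Longrightarrow>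
        \<bar>pd3 (G l) a b c \<theta>\<bar> \<le> w ^ 6"
    and b: "b \<in> Basis" and c: "c \<in> Basis" and lam: "lam \<in> cball lam0 e"
  defines "F \<equiv> \<lambda>k lam. ln (softmax (\<lambda>l. gam lam l + G l (fst lam)) k)"
  shows hess_log_prob_bound: "\<bar>hess (F k) b c lam\<bar> \<le> (1 + real CARD('k option)) ^ 2 * w ^ 6"
    and hess_log_prob_lipschitz: "\<bar>hess (F k) b c lam - hess (F k) b c lam0\<bar> \<le>
       real DIM((real^'s) \<times> (real^'k)) * (1 + 7 * real CARD('k option) + 6 * real CARD('k option) ^ 2)
         * dist lam lam0 * w ^ 6"
proof -
  let ?u = "\<lambda>l lam. gam lam l + G l (fst lam)"
  have th: "fst z \<in> cball (fst lam0) e" if "z \<in> cball lam0 e" for z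
    using that dist_fst_le[of lam0 z] by simp
  have wp: "1 \<le> w ^ i" for i :: nat
    using w by simp
  have wp0: "0 \<le> w ^ i" for i :: nat
    using w by simp
  have 1: "\<bar>pd (?u l) b z\<bar> \<le> w ^ 2" if "b \<in> Basis" "z \<in> cball lam0 e" for l b z
  proof -
    have eq: "pd (?u l) b z = gam b l + pd (G l) (fst b) (fst z)"
      by (rule fun_cong[OF pd_linear_predictor[of G, OF G that(1)]])
    show ?thesis
      using bnd1[OF _ th[OF that(2)], of "fst b" l] order_trans[OF abs_gam_Basis_le[OF that(1), of l] wp]
      unfolding eq by (cases rule: fst_Basis_cases[OF that(1)]) (simp_all add: gam_snd_zero)
  qed
  have 2: "\<bar>hess (?u l) b c z\<bar> \<le> w ^ 3" if "b \<in> Basis" "c \<in> Basis" "z \<in> cball lam0 e" for l b c z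
    using bnd2[OF _ _ th[OF that(3)], of "fst b" "fst c" l] wp0[of 3]
    by (cases rule: fst_Basis_cases[OF that(1)]; cases rule: fst_Basis_cases[OF that(2)])
       (simp_all add: hess_linear_predictor[of G, OF G that(1)])
  have 3: "\<bar>pd3 (?u l) b c d z\<bar> \<le> w ^ 6"
    if "b \<in> Basis" "c \<in> Basis" "d \<in> Basis" "z \<in> cball lam0 e" for l b c d z
    using bnd3[OF _ _ _ th[OF that(4)], of "fst b" "fst c" "fst d" l] wp0[of 6]
    by (cases rule: fst_Basis_cases[OF that(1)]; cases rule: fst_Basis_cases[OF that(2)];
        cases rule: fst_Basis_cases[OF that(3)])
       (simp_all add: pd3_linear_predictor[of G, OF G that(1)])
  show "\<bar>hess (F k) b c lam\<bar> \<le> (1 + real CARD('k option)) ^ 2 * w ^ 6"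
    unfolding F_def by (rule hess_ln_softmax_bound[OF Ck3_linear_predictor[OF G] w 1 2 3 b c lam])
  show "\<bar>hess (F k) b c lam - hess (F k) b c lam0\<bar> \<le>
       real DIM((real^'s) \<times> (real^'k)) * (1 + 7 * real CARD('k option) + 6 * real CARD('k option) ^ 2)
         * dist lam lam0 * w ^ 6"
    unfolding F_def by (rule hess_ln_softmax_lipschitz[OF Ck3_linear_predictor[OF G] w 1 2 3 b c lam])
qed

section \<open>The Hessian of the log-likelihood: decomposition, continuity, measurability\<close>

lemma pstar_eq_softmax:
  "pstar psi k x = (\<lambda>lam. softmax (\<lambda>l. gam lam l + psi (fst lam) x l) k)"
  by (auto simp: pstar_def softmax_def)

lemma Jn_eq_sum_hess:
  assumes psi: "\<And>k i l. Ck 3 (\<lambda>\<theta>. psi \<theta> (X k i w) l)" and b: "b \<in> Basis" and c: "c \<in> Basis"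
  shows "Jn psi X ns w lam b c = (\<Sum>k\<in>UNIV. \<Sum>i<ns k. - hess (\<lambda>l. ln (pstar psi k (X k i w) l)) b c lam)"
    and "continuous_on UNIV (\<lambda>lam. Jn psi X ns w lam b c)"
proof -
  \<comment> \<open>Category and observation number are merged into one finite index set, so that
    additivity of the Hessian is applied once.\<close>
  let ?J = "SIGMA k:UNIV. {..<ns k}"
  let ?u = "\<lambda>p l lam. gam lam l + psi (fst lam) (X (fst p) (snd p) w) l"
  have u: "Ck (Suc (Suc 1)) (?u p l)" for p l
    using Ck3_linear_predictor[of "\<lambda>l \<theta>. psi \<theta> (X (fst p) (snd p) w) l", OF psi]
    by (simp only: numeral_3_eq_3 One_nat_def)
  have "loglik psi X ns w = (\<lambda>lam. \<Sum>p\<in>?J. ln (softmax (\<lambda>l. ?u p l lam) (fst p)))"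
    by (simp add: loglik_def[abs_def] pstar_eq_softmax sum.Sigma split_beta)
  then have *: "hess (loglik psi X ns w) b c lam =
      (\<Sum>p\<in>?J. hess (\<lambda>lam. ln (softmax (\<lambda>l. ?u p l lam) (fst p))) b c lam)" for lam
    using hess_sum_ln_softmax[of ?J 1 ?u, OF u b c] by simp
  show "Jn psi X ns w lam b c = (\<Sum>k\<in>UNIV. \<Sum>i<ns k. - hess (\<lambda>l. ln (pstar psi k (X k i w) l)) b c lam)"
    by (simp add: Jn_def * pstar_eq_softmax sum.Sigma split_beta sum_negf)
  have "continuous_on UNIV (hess (\<lambda>lam. ln (softmax (\<lambda>l. ?u p l lam) (fst p))) b c)" for p
    by (rule continuous_on_hess_ln_softmax[OF u b c])
  then show "continuous_on UNIV (\<lambda>lam. Jn psi X ns w lam b c)"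
    unfolding Jn_def * by (intro continuous_intros)
qed

text \<open>Measurability in \<open>x\<close> of a derivative in the parameter is read off from the
  closed formula for the Hessian, which holds at all points of \<open>space nu\<close>.\<close>

lemma borel_measurable_hess_log_prob:
  assumes psi: "\<And>x l. x \<in> space nu \<Longrightarrow> Ck 3 (\<lambda>\<theta>. psi \<theta> x l)"
    and meas0: "\<And>l. (\<lambda>x. psi (fst lam) x l) \<in> borel_measurable nu"
    and meas1: "\<And>a l. a \<in> Basis \<Longrightarrow> (\<lambda>x. pd (\<lambda>\<theta>. psi \<theta> x l) a (fst lam)) \<in> borel_measurable nu"
    and meas2: "\<And>a b l. a \<in> Basis \<Longrightarrow> b \<in> Basis \<Longrightarrow>
      (\<lambda>x. hess (\<lambda>\<theta>. psi \<theta> x l) a b (fst lam)) \<in> borel_measurable nu"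
    and b: "b \<in> Basis" and c: "c \<in> Basis"
  shows "(\<lambda>x. hess (\<lambda>l. ln (pstar psi k x l)) b c lam) \<in> borel_measurable nu"
proof -
  have m1: "(\<lambda>x. pd (\<lambda>\<theta>. psi \<theta> x l) (fst b) (fst lam)) \<in> borel_measurable nu" if "b \<in> Basis" for b :: "_ \<times> (real^'k)" and l
    using meas1[of "fst b" l] by (cases rule: fst_Basis_cases[OF that]) simp_all
  have m2: "(\<lambda>x. hess (\<lambda>\<theta>. psi \<theta> x l) (fst b) (fst c) (fst lam)) \<in> borel_measurable nu" for l
    using meas2[of "fst b" "fst c" l]
    by (cases rule: fst_Basis_cases[OF b]; cases rule: fst_Basis_cases[OF c]) simp_all
  have sm: "(\<lambda>x. softmax (\<lambda>l. gam lam l + psi (fst lam) x l) k) \<in> borel_measurable nu" for k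
    unfolding softmax_def using meas0
    by (intro borel_measurable_divide borel_measurable_sum borel_measurable_exp borel_measurable_add) auto
  have "hess (\<lambda>l. ln (pstar psi k x l)) b c lam =
     hess (\<lambda>\<theta>. psi \<theta> x k) (fst b) (fst c) (fst lam)
     - (\<Sum>l\<in>UNIV. softmax (\<lambda>l. gam lam l + psi (fst lam) x l) l * hess (\<lambda>\<theta>. psi \<theta> x l) (fst b) (fst c) (fst lam))
     - (\<Sum>l\<in>UNIV. softmax (\<lambda>l. gam lam l + psi (fst lam) x l) l
         * (gam b l + pd (\<lambda>\<theta>. psi \<theta> x l) (fst b) (fst lam)) * (gam c l + pd (\<lambda>\<theta>. psi \<theta> x l) (fst c) (fst lam)))
     + (\<Sum>l\<in>UNIV. softmax (\<lambda>l. gam lam l + psi (fst lam) x l) l * (gam b l + pd (\<lambda>\<theta>. psi \<theta> x l) (fst b) (fst lam)))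
       * (\<Sum>l\<in>UNIV. softmax (\<lambda>l. gam lam l + psi (fst lam) x l) l * (gam c l + pd (\<lambda>\<theta>. psi \<theta> x l) (fst c) (fst lam)))"
    if "x \<in> space nu" for x
  proof -
    have u: "Ck (Suc (Suc 1)) (\<lambda>lam. gam lam l + psi (fst lam) x l)" for l
      using Ck3_linear_predictor[of "\<lambda>l \<theta>. psi \<theta> x l", OF psi[OF that]]
      by (simp only: numeral_3_eq_3 One_nat_def)
    show ?thesis
      unfolding pstar_eq_softmax hess_ln_softmax[OF u b c]
      by (simp only: pd_linear_predictor[of "\<lambda>l \<theta>. psi \<theta> x l", OF psi[OF that] b]
          pd_linear_predictor[of "\<lambda>l \<theta>. psi \<theta> x l", OF psi[OF that] c]
          hess_linear_predictor[of "\<lambda>l \<theta>. psi \<theta> x l", OF psi[OF that] b])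
  qed
  then show ?thesis
    by (simp cong: measurable_cong)
       (intro borel_measurable_add borel_measurable_diff borel_measurable_times borel_measurable_sum
          m1 m2 sm b c borel_measurable_const)
qed

text \<open>The matrices have finitely many entries, so convergence in probability is stated entry
  by entry, an entry being given by two basis vectors \<open>b\<close> and \<open>c\<close>.\<close>

theorem theorem6:
  fixes nu :: "'x measure" and MY :: "'y measure"
    and y :: "'k::finite option \<Rightarrow> 'y"
    and hX :: "'x \<Rightarrow> 'z::euclidean_space" and hY :: "'y \<Rightarrow> 'v::euclidean_space"
    and G :: "'z \<Rightarrow> 'v \<Rightarrow> real^'s \<Rightarrow> real"
    and psi :: "real^'s \<Rightarrow> 'x \<Rightarrow> 'k option \<Rightarrow> real"
    and theta0 :: "real^'s"
    and f :: "'k option \<Rightarrow> 'x \<Rightarrow> real" and beta :: "'x \<Rightarrow> real"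
    and eps :: "'k option \<Rightarrow> real" and r :: "'k option \<Rightarrow> real"
    and M :: "'w measure" and X :: "'k option \<Rightarrow> nat \<Rightarrow> 'w \<Rightarrow> 'x"
    and N :: "nat \<Rightarrow> nat" and ns :: "nat \<Rightarrow> 'k option \<Rightarrow> nat"
    and lhat :: "nat \<Rightarrow> 'w \<Rightarrow> (real^'s) \<times> (real^'k)"
  assumes nu: "sigma_finite_measure nu"
    and y_inj: "inj y" and y_space: "\<forall>k. y k \<in> space MY"
    and hX_meas: "hX \<in> borel_measurable nu" and hY_meas: "hY \<in> borel_measurable MY"
    and hY0: "hY (y None) = 0"
    and G_z0: "\<forall>z \<theta>. G z 0 \<theta> = 0" and G_0v: "\<forall>v \<theta>. G 0 v \<theta> = 0"
    and R1: "\<forall>z\<in>hX ` space nu. \<forall>v\<in>hY ` space MY. Ck 3 (G z v)"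
    and R1_cont: "\<forall>\<theta>. \<forall>b\<in>Basis. \<forall>c\<in>Basis. \<forall>d\<in>Basis.
        continuous_on (hX ` space nu \<times> hY ` space MY) (\<lambda>(z, v). pd (G z v) b \<theta>) \<and>
        continuous_on (hX ` space nu \<times> hY ` space MY) (\<lambda>(z, v). hess (G z v) b c \<theta>) \<and>
        continuous_on (hX ` space nu \<times> hY ` space MY) (\<lambda>(z, v). pd3 (G z v) b c d \<theta>)"
    and psi_def: "\<forall>\<theta> x k. psi \<theta> x k = G (hX x) (hY (y k)) \<theta>"
    and f_meas: "\<forall>k. f k \<in> borel_measurable nu"
    and f_pos: "\<forall>k. \<forall>x\<in>space nu. f k x > 0"
    and beta_meas: "beta \<in> borel_measurable nu"
    and f_form: "\<forall>k. \<forall>x\<in>space nu. ln (f k x) = beta x + psi theta0 x k - eps k"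
    and M: "prob_space M"
    and X_distr: "\<forall>k i. distributed M nu (X k i) (\<lambda>x. ennreal (f k x))"
    and X_indep: "prob_space.indep_vars M (\<lambda>_. nu) (\<lambda>(k, i). X k i) UNIV"
    and r_pos: "\<forall>k. r k > 0" and r_sum: "(\<Sum>k\<in>UNIV. r k) = 1"
    and N_mono: "strict_mono N"
    and ns_def: "\<forall>m k. real (ns m k) = r k * real (N m)"
    and lhat_meas: "\<forall>m. lhat m \<in> borel_measurable (sample_sigma M nu X (ns m))"
    and N2: "conv_in_prob M lhat (theta0, gamma0 r eps)"
    and MC: "\<exists>e0>0. \<forall>k. \<forall>a\<in>Basis. \<forall>b\<in>Basis. \<forall>c\<in>Basis.
        (\<integral>\<^sup>+x. (\<Squnion>\<theta>\<in>cball theta0 e0. ennreal (Hr G hY y a (hX x) \<theta> ^ 3))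
            \<partial>density nu (\<lambda>x. ennreal (f k x))) < \<infinity> \<and>
        (\<integral>\<^sup>+x. (\<Squnion>\<theta>\<in>cball theta0 e0. ennreal (Hrs G hY y b c (hX x) \<theta> ^ 2))
            \<partial>density nu (\<lambda>x. ennreal (f k x))) < \<infinity> \<and>
        (\<integral>\<^sup>+x. (\<Squnion>\<theta>\<in>cball theta0 e0. ennreal (Hrst G hY y a b c (hX x) \<theta>))
            \<partial>density nu (\<lambda>x. ennreal (f k x))) < \<infinity>"
  shows "\<forall>b\<in>Basis. \<forall>c\<in>Basis.
     conv_in_prob M
       (\<lambda>m w. (1 / real (N m)) * integral {0..1}
          (\<lambda>t. Jn psi X (ns m) w ((theta0, gamma0 r eps) + t *\<^sub>R (lhat m w - (theta0, gamma0 r eps))) b c))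
       (Ibar nu f r psi (theta0, gamma0 r eps) b c) \<and>
     conv_in_prob M
       (\<lambda>m w. (1 / real (N m)) * Jn psi X (ns m) w (lhat m w) b c)
       (Ibar nu f r psi (theta0, gamma0 r eps) b c)"
proof (intro ballI)
  fix b c :: "(real^'s) \<times> (real^'k)" assume b: "b \<in> Basis" and c: "c \<in> Basis"
  interpret prob_space M by (rule M)
  define lam0 where "lam0 = (theta0, gamma0 r eps)"
  define P where "P k = density nu (\<lambda>x. ennreal (f k x))" for k
  define H where "H k x lam = hess (\<lambda>l. ln (pstar psi k x l)) b c lam" for k x lam
  have sets_P: "sets (P k) = sets nu" for k by (simp add: P_def)
  have X_meas: "X k i \<in> measurable M nu" for k i
    using X_distr by (auto simp: distributed_def)
  have X_P: "distr M nu (X k i) = P k" for k i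
    unfolding P_def using X_distr by (intro distributed_distr_eq_density) auto
  have prob_P: "prob_space (P k)" for k
    using prob_space_distr[OF X_meas[of k 0]] by (simp add: X_P)
  have psi_G: "(\<lambda>\<theta>. psi \<theta> x k) = G (hX x) (hY (y k))" for x k
    using psi_def by auto
  have y_V: "hY (y k) \<in> hY ` space MY" for k
    using y_space by auto
  have G3: "Ck 3 (G (hX x) (hY (y k)))" if "x \<in> space nu" for x k
    using R1[rule_format, OF imageI[OF that] y_V] .
  have Ck_G: "Ck (Suc (Suc (Suc 0))) (G (hX x) (hY (y k)))" if "x \<in> space nu" for x k
    using G3[OF that] by (simp only: numeral_3_eq_3)
  have meas1: "(\<lambda>x. pd (G (hX x) (hY (y k))) a \<theta>) \<in> borel_measurable nu" if "a \<in> Basis" for a k \<theta>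
    using measurable_slice[of hX nu "hY ` space MY" "\<lambda>z v. pd (G z v) a \<theta>", OF _ hX_meas y_V]
      R1_cont that by blast
  have meas2: "(\<lambda>x. hess (G (hX x) (hY (y k))) a a' \<theta>) \<in> borel_measurable nu"
    if "a \<in> Basis" "a' \<in> Basis" for a a' k \<theta>
    using measurable_slice[of hX nu "hY ` space MY" "\<lambda>z v. hess (G z v) a a' \<theta>", OF _ hX_meas y_V]
      R1_cont that by blast
  have meas3: "(\<lambda>x. pd3 (G (hX x) (hY (y k))) a a' a'' \<theta>) \<in> borel_measurable nu"
    if "a \<in> Basis" "a' \<in> Basis" "a'' \<in> Basis" for a a' a'' k \<theta>
    using measurable_slice[of hX nu "hY ` space MY" "\<lambda>z v. pd3 (G z v) a a' a'' \<theta>", OF _ hX_meas y_V]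
      R1_cont that by blast
  have cont1: "continuous_on S (pd (G (hX x) (hY (y k))) a)" if "x \<in> space nu" "a \<in> Basis" for x k a S
    using Ck_imp_continuous[OF Ck_pd[OF Ck_G[OF that(1)] that(2)]] continuous_on_subset by blast
  have cont2: "continuous_on S (hess (G (hX x) (hY (y k))) a a')"
    if "x \<in> space nu" "a \<in> Basis" "a' \<in> Basis" for x k a a' S
    unfolding hess_def[abs_def]
    using Ck_imp_continuous[OF Ck_pd[OF Ck_pd[OF Ck_G[OF that(1)] that(2)] that(3)]]
      continuous_on_subset by blast
  have cont3: "continuous_on S (pd3 (G (hX x) (hY (y k))) a a' a'')"
    if "x \<in> space nu" "a \<in> Basis" "a' \<in> Basis" "a'' \<in> Basis" for x k a a' a'' S
    unfolding pd3_def[abs_def] hess_def[abs_def]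
    using Ck_imp_continuous[OF Ck_pd[OF Ck_pd[OF Ck_pd[OF Ck_G[OF that(1)] that(2)] that(3)] that(4)]]
      continuous_on_subset by blast
  obtain e0 where e0: "e0 > 0" and MC1: "\<And>k a. a \<in> Basis \<Longrightarrow>
        (\<integral>\<^sup>+x. (\<Squnion>\<theta>\<in>cball theta0 e0. ennreal (Hr G hY y a (hX x) \<theta> ^ 3)) \<partial>P k) < \<infinity>"
    and MC2: "\<And>k a a'. a \<in> Basis \<Longrightarrow> a' \<in> Basis \<Longrightarrow>
        (\<integral>\<^sup>+x. (\<Squnion>\<theta>\<in>cball theta0 e0. ennreal (Hrs G hY y a a' (hX x) \<theta> ^ 2)) \<partial>P k) < \<infinity>"
    and MC3: "\<And>k a a' a''. a \<in> Basis \<Longrightarrow> a' \<in> Basis \<Longrightarrow> a'' \<in> Basis \<Longrightarrow>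
        (\<integral>\<^sup>+x. (\<Squnion>\<theta>\<in>cball theta0 e0. ennreal (Hrst G hY y a a' a'' (hX x) \<theta>)) \<partial>P k) < \<infinity>"
    using MC unfolding P_def by blast
  let ?S = "cball theta0 e0"
  \<comment> \<open>One envelope for each order of differentiation; the directions are finite in
    number, so a single function covers all of them and is integrable under every
    \<open>P k\<close>.\<close>
  have "\<exists>W. (\<forall>x. 0 \<le> W x) \<and> W \<in> borel_measurable nu \<and> (\<forall>k. integrable (P k) W) \<and>
    (\<forall>a\<in>Basis. \<forall>x\<in>space nu. \<forall>\<theta>\<in>?S. Hr G hY y a (hX x) \<theta> ^ 3 \<le> W x)"
    by (rule integrable_envelope_family)
       (auto simp: Hr_def sets_P intro!: continuous_intros cont1 borel_measurable_power
          borel_measurable_sum borel_measurable_abs meas1 MC1[unfolded Hr_def infinity_ennreal_def])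
  then obtain W1 where W1: "\<And>x. 0 \<le> W1 x" "W1 \<in> borel_measurable nu" "\<And>k. integrable (P k) W1"
    "\<And>a x \<theta>. a \<in> Basis \<Longrightarrow> x \<in> space nu \<Longrightarrow> \<theta> \<in> ?S \<Longrightarrow> Hr G hY y a (hX x) \<theta> ^ 3 \<le> W1 x"
    by blast
  have "\<exists>W. (\<forall>x. 0 \<le> W x) \<and> W \<in> borel_measurable nu \<and> (\<forall>k. integrable (P k) W) \<and>
    (\<forall>i\<in>Basis \<times> Basis. \<forall>x\<in>space nu. \<forall>\<theta>\<in>?S. Hrs G hY y (fst i) (snd i) (hX x) \<theta> ^ 2 \<le> W x)"
    by (rule integrable_envelope_family)
       (auto simp: Hrs_def sets_P intro!: continuous_intros cont2 borel_measurable_power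
          borel_measurable_sum borel_measurable_abs meas2 MC2[unfolded Hrs_def infinity_ennreal_def])
  then obtain W2 where W2: "\<And>x. 0 \<le> W2 x" "W2 \<in> borel_measurable nu" "\<And>k. integrable (P k) W2"
    "\<And>a a' x \<theta>. a \<in> Basis \<Longrightarrow> a' \<in> Basis \<Longrightarrow> x \<in> space nu \<Longrightarrow> \<theta> \<in> ?S \<Longrightarrow>
       Hrs G hY y a a' (hX x) \<theta> ^ 2 \<le> W2 x"
    by force
  have "\<exists>W. (\<forall>x. 0 \<le> W x) \<and> W \<in> borel_measurable nu \<and> (\<forall>k. integrable (P k) W) \<and>
    (\<forall>i\<in>Basis \<times> Basis \<times> Basis. \<forall>x\<in>space nu. \<forall>\<theta>\<in>?S.
       Hrst G hY y (fst i) (fst (snd i)) (snd (snd i)) (hX x) \<theta> \<le> W x)"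
    by (rule integrable_envelope_family)
       (auto simp: Hrst_def sets_P intro!: continuous_intros cont3
          borel_measurable_sum borel_measurable_abs meas3 MC3[unfolded Hrst_def infinity_ennreal_def])
  then obtain W3 where W3: "\<And>x. 0 \<le> W3 x" "W3 \<in> borel_measurable nu" "\<And>k. integrable (P k) W3"
    "\<And>a a' a'' x \<theta>. a \<in> Basis \<Longrightarrow> a' \<in> Basis \<Longrightarrow> a'' \<in> Basis \<Longrightarrow> x \<in> space nu \<Longrightarrow> \<theta> \<in> ?S \<Longrightarrow>
       Hrst G hY y a a' a'' (hX x) \<theta> \<le> W3 x"
    by force
  \<comment> \<open>The summand 1 ensures that the sixth root of \<open>W x\<close> is at least 1;
    it is integrable because \<open>P k\<close> is a probability measure.\<close>
  define W where "W x = 1 + W1 x + W2 x + W3 x" for x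
  have W_meas: "W \<in> borel_measurable nu"
    unfolding W_def by (intro borel_measurable_add borel_measurable_const W1 W2 W3)
  have W_int: "integrable (P k) W" for k
    unfolding W_def using prob_space.finite_measure[OF prob_P[of k]] W1 W2 W3
    by (intro Bochner_Integration.integrable_add finite_measure.integrable_const)
  define C1 where "C1 = (1 + real CARD('k option)) ^ 2"
  define C2 where "C2 = real DIM((real^'s) \<times> (real^'k))
    * (1 + 7 * real CARD('k option) + 6 * real CARD('k option) ^ 2)"
  have H_bnd: "\<bar>H k x lam\<bar> \<le> C1 * W x" "\<bar>H k x lam - H k x lam0\<bar> \<le> C2 * dist lam lam0 * W x"
    if x: "x \<in> space nu" and lam: "lam \<in> cball lam0 e0" for k x lam
  proof -
    \<comment> \<open>the sixth root makes both the cube roots and the square roots of the moments integer powers\<close>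
    define w where "w = root 6 (W x)"
    have W: "W x \<ge> 1" "W1 x \<le> W x" "W2 x \<le> W x" "W3 x \<le> W x"
      using W1(1)[of x] W2(1)[of x] W3(1)[of x] by (auto simp: W_def)
    have w: "w \<ge> 1" "w ^ 6 = W x"
      using W(1) real_root_pow_pos2[of 6 "W x"] by (auto simp: w_def)
    let ?g = "\<lambda>l. G (hX x) (hY (y l))"
    have 1: "\<bar>pd (?g l) a \<theta>\<bar> \<le> w ^ 2" if "a \<in> Basis" "\<theta> \<in> cball (fst lam0) e0" for l a \<theta>
    proof -
      have "Hr G hY y a (hX x) \<theta> ^ 3 \<le> W x"
        using W1(4)[OF that(1) x] W(2) that(2) by (force simp: lam0_def)
      also have "\<dots> = (w ^ 2) ^ 3" using w(2) by (simp flip: power_mult)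
      finally have "Hr G hY y a (hX x) \<theta> \<le> w ^ 2"
        using power_le_imp_le_base[of _ 2 "w ^ 2"] w(1) by (simp add: numeral_3_eq_3)
      moreover have "\<bar>pd (?g l) a \<theta>\<bar> \<le> Hr G hY y a (hX x) \<theta>"
        unfolding Hr_def by (rule member_le_sum[where f = "\<lambda>k. \<bar>pd (?g k) a \<theta>\<bar>"]) auto
      ultimately show ?thesis by linarith
    qed
    have 2: "\<bar>hess (?g l) a a' \<theta>\<bar> \<le> w ^ 3"
      if "a \<in> Basis" "a' \<in> Basis" "\<theta> \<in> cball (fst lam0) e0" for l a a' \<theta>
    proof -
      have "Hrs G hY y a a' (hX x) \<theta> ^ 2 \<le> W x"
        using W2(4)[OF that(1,2) x] W(3) that(3) by (force simp: lam0_def)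
      also have "\<dots> = (w ^ 3) ^ 2" using w(2) by (simp flip: power_mult)
      finally have "Hrs G hY y a a' (hX x) \<theta> \<le> w ^ 3"
        by (rule power2_le_imp_le) (use w(1) in simp)
      moreover have "\<bar>hess (?g l) a a' \<theta>\<bar> \<le> Hrs G hY y a a' (hX x) \<theta>"
        unfolding Hrs_def by (rule member_le_sum[where f = "\<lambda>k. \<bar>hess (?g k) a a' \<theta>\<bar>"]) auto
      ultimately show ?thesis by linarith
    qed
    have 3: "\<bar>pd3 (?g l) a a' a'' \<theta>\<bar> \<le> w ^ 6"
      if "a \<in> Basis" "a' \<in> Basis" "a'' \<in> Basis" "\<theta> \<in> cball (fst lam0) e0" for l a a' a'' \<theta>
    proof -
      have "Hrst G hY y a a' a'' (hX x) \<theta> \<le> W x"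
        using W3(4)[OF that(1-3) x] W(4) that(4) by (force simp: lam0_def)
      moreover have "\<bar>pd3 (?g l) a a' a'' \<theta>\<bar> \<le> Hrst G hY y a a' a'' (hX x) \<theta>"
        unfolding Hrst_def by (rule member_le_sum[where f = "\<lambda>k. \<bar>pd3 (?g k) a a' a'' \<theta>\<bar>"]) auto
      ultimately show ?thesis using w(2) by linarith
    qed
    have H_eq: "H k x = hess (\<lambda>lam. ln (softmax (\<lambda>l. gam lam l + ?g l (fst lam)) k)) b c"
      using psi_def by (simp add: H_def[abs_def] pstar_eq_softmax)
    show "\<bar>H k x lam\<bar> \<le> C1 * W x"
      using hess_log_prob_bound[of ?g w lam0 e0 b c lam k, OF G3[OF x] w(1) 1 2 3 b c lam]
      by (simp only: H_eq C1_def w(2))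
    show "\<bar>H k x lam - H k x lam0\<bar> \<le> C2 * dist lam lam0 * W x"
      using hess_log_prob_lipschitz[of ?g w lam0 e0 b c lam k, OF G3[OF x] w(1) 1 2 3 b c lam]
      by (simp only: H_eq C2_def w(2))
  qed
  \<comment> \<open>The continuity assumption concerns the derivatives of \<open>G\<close>;
    measurability of \<open>psi\<close> itself at the true parameter is recovered by solving the
    log-density equation for it.\<close>
  have psi0_meas: "(\<lambda>x. psi theta0 x k) \<in> borel_measurable nu" for k
  proof -
    have "(\<lambda>x. ln (f k x) - beta x + eps k) \<in> borel_measurable nu"
      using f_meas beta_meas by (intro borel_measurable_add borel_measurable_diff borel_measurable_ln) auto
    moreover have "psi theta0 x k = ln (f k x) - beta x + eps k" if "x \<in> space nu" for x
      using f_form that by simp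
    ultimately show ?thesis by (simp cong: measurable_cong)
  qed
  have H_meas: "(\<lambda>x. H k x lam0) \<in> borel_measurable nu" for k
    unfolding H_def lam0_def
    by (rule borel_measurable_hess_log_prob)
       (simp_all add: psi_G G3 psi0_meas meas1 meas2 b c)
  have H_int: "integrable (P k) (\<lambda>x. - H k x lam0)" for k
  proof (rule Bochner_Integration.integrable_bound)
    show "integrable (P k) (\<lambda>x. C1 * W x)"
      using W_int by simp
    show "(\<lambda>x. - H k x lam0) \<in> borel_measurable (P k)"
      using H_meas[of k] by (subst measurable_cong_sets[OF sets_P refl]) simp
    show "AE x in P k. norm (- H k x lam0) \<le> norm (C1 * W x)"
      using H_bnd(1)[of _ lam0 k] e0 by (intro AE_I2) (force simp: P_def)
  qed
  have ns_lim: "filterlim (\<lambda>m. ns m k) at_top sequentially" for k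
  proof -
    have "filterlim (\<lambda>m. r k * real (N m)) at_top sequentially"
      using r_pos filterlim_compose[OF filterlim_real_sequentially filterlim_subseq[OF N_mono]]
      by (intro filterlim_tendsto_pos_mult_at_top[OF tendsto_const]) auto
    then have "\<forall>\<^sub>F m in sequentially. real Z \<le> real (ns m k)" for Z
      using ns_def by (simp add: filterlim_at_top)
    then show ?thesis by (simp add: filterlim_at_top)
  qed
  define mean where "mean g m w = (\<Sum>k\<in>UNIV. r k * ((\<Sum>i<ns m k. g k (X k i w)) / real (ns m k)))"
    for g :: "'k option \<Rightarrow> 'x \<Rightarrow> real" and m w
  have mean_eq: "mean g m w = (1 / real (N m)) * (\<Sum>k\<in>UNIV. \<Sum>i<ns m k. g k (X k i w))" for g m w
  proof -
    \<comment> \<open>Stratum sizes proportional to \<open>r k\<close> turn the stratum weights into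
      the global factor; if \<open>N m = 0\<close>, both sides are 0 because division by 0 yields
      0.\<close>
    have "r k * (s / real (ns m k)) = (1 / real (N m)) * s" for k and s :: real
      using r_pos[rule_format, of k] ns_def by (cases "N m = 0") auto
    then show ?thesis by (simp only: mean_def sum_distrib_left)
  qed
  have mean_conv: "conv_in_prob M (mean g) (\<Sum>k\<in>UNIV. r k * integral\<^sup>L (P k) (g k))"
    if "\<And>k. g k \<in> borel_measurable nu" "\<And>k. integrable (P k) (g k)" for g
    unfolding mean_def[abs_def]
    by (rule conv_in_prob_stratified_mean[OF X_indep X_meas X_P that ns_lim])
  have mean_meas: "mean g m \<in> borel_measurable M" if "\<And>k. g k \<in> borel_measurable nu" for g m
    unfolding mean_def[abs_def]
    by (intro borel_measurable_sum borel_measurable_times borel_measurable_divide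
          borel_measurable_const measurable_compose[OF X_meas that])
  define A where "A = mean (\<lambda>k x. - H k x lam0)"
  define V where "V = mean (\<lambda>_. W)"
  have A_conv: "conv_in_prob M A (Ibar nu f r psi lam0 b c)"
    unfolding A_def Ibar_def H_def[symmetric] P_def[symmetric]
    by (rule mean_conv) (use H_meas H_int in auto)
  \<comment> \<open>The sigma-algebra of the sample is generated by events of \<open>M\<close>,
    hence is contained in that of \<open>M\<close>.\<close>
  have lhat_M: "lhat m \<in> borel_measurable M" for m
  proof -
    have gen: "{X k i -` B \<inter> space M | k i B. i < ns m k \<and> B \<in> sets nu} \<subseteq> sets M"
      using measurable_sets[OF X_meas] by auto
    have "sets (sample_sigma M nu X (ns m)) \<subseteq> sets M"
      unfolding sample_sigma_def using gen sets.space_closed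
      by (subst sets_measure_of) (blast intro: sets.sigma_sets_subset[THEN subsetD])+
    moreover have "space (sample_sigma M nu X (ns m)) = space M"
      unfolding sample_sigma_def by (rule space_measure_of_conv)
    ultimately show ?thesis
      using lhat_meas measurable_mono[OF subset_refl refl] by blast
  qed
  define Q where "Q m w lam = (1 / real (N m)) * Jn psi X (ns m) w lam b c" for m w lam
  have Xw: "X k i w \<in> space nu" if "w \<in> space M" for k i w
    using measurable_space[OF X_meas that] .
  have psi3: "Ck 3 (\<lambda>\<theta>. psi \<theta> (X k i w) l)" if "w \<in> space M" for k i l w
    using G3[OF Xw[OF that]] by (simp add: psi_G)
  have Q_eq: "Q m w lam = mean (\<lambda>k x. - H k x lam) m w" if "w \<in> space M" for m w lam
    unfolding Q_def mean_eq H_def by (simp only: Jn_eq_sum_hess(1)[where psi = psi and X = X, OF psi3[OF that] b c])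
  have Q_cont: "continuous_on UNIV (Q m w)" if "w \<in> space M" for m w
    unfolding Q_def[abs_def] by (intro continuous_intros Jn_eq_sum_hess(2)[where psi = psi and X = X, OF psi3[OF that] b c])
  have Q_bnd: "\<bar>Q m w lam - A m w\<bar> \<le> C2 * dist lam lam0 * V m w"
    if w: "w \<in> space M" and lam: "dist lam lam0 \<le> e0" for m w lam
  proof -
    have "\<bar>Q m w lam - A m w\<bar>
        = (1 / real (N m)) * \<bar>\<Sum>k\<in>UNIV. \<Sum>i<ns m k. H k (X k i w) lam0 - H k (X k i w) lam\<bar>"
      unfolding Q_eq[OF w] A_def mean_eq
      by (simp add: abs_mult flip: right_diff_distrib diff_divide_distrib sum_subtractf)
    also have "\<dots> \<le> (1 / real (N m)) * (\<Sum>k\<in>UNIV. \<Sum>i<ns m k. C2 * dist lam lam0 * W (X k i w))"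
    proof (intro mult_left_mono order_trans[OF sum_abs] sum_mono)
      fix k i
      show "\<bar>H k (X k i w) lam0 - H k (X k i w) lam\<bar> \<le> C2 * dist lam lam0 * W (X k i w)"
        using H_bnd(2)[OF Xw[OF w], of lam k] lam by (simp add: dist_commute abs_minus_commute)
    qed simp
    also have "\<dots> = C2 * dist lam lam0 * V m w"
      unfolding V_def mean_eq by (simp add: sum_distrib_left mult.left_commute)
    finally show ?thesis .
  qed
  \<comment> \<open>Both conclusions have the same limit and differ only in \<open>T\<close>, so
    each is reduced to this pointwise bound.\<close>
  have slutsky: "conv_in_prob M T (Ibar nu f r psi lam0 b c)"
    if "\<And>m w. w \<in> space M \<Longrightarrow> dist (lhat m w) lam0 \<le> e0 \<Longrightarrow>
      \<bar>T m w - A m w\<bar> \<le> C2 * dist (lhat m w) lam0 * V m w" for T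
  proof (rule conv_in_prob_of_lipschitz_bound[OF A_conv _ _ _ _ lhat_M e0 _ that])
    show "conv_in_prob M V (\<Sum>k\<in>UNIV. r k * integral\<^sup>L (P k) W)"
      unfolding V_def by (rule mean_conv) (use W_meas W_int in auto)
    show "conv_in_prob M lhat lam0" using N2 by (simp add: lam0_def)
    show "C2 \<ge> 0" by (simp add: C2_def)
  qed (auto simp: A_def V_def intro!: mean_meas borel_measurable_uminus H_meas W_meas)
  have V_nonneg: "V m w \<ge> 0" for m w
    unfolding V_def mean_eq W_def using W1(1) W2(1) W3(1)
    by (intro mult_nonneg_nonneg sum_nonneg add_nonneg_nonneg) auto
  have N4: "conv_in_prob M (\<lambda>m w. Q m w (lhat m w)) (Ibar nu f r psi lam0 b c)"
    by (rule slutsky) (rule Q_bnd)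
  have N3: "conv_in_prob M (\<lambda>m w. (1 / real (N m)) *
      integral {0..1} (\<lambda>t. Jn psi X (ns m) w (lam0 + t *\<^sub>R (lhat m w - lam0)) b c))
      (Ibar nu f r psi lam0 b c)"
  proof (rule slutsky)
    fix m w assume w: "w \<in> space M" and l: "dist (lhat m w) lam0 \<le> e0"
    let ?p = "\<lambda>t. lam0 + t *\<^sub>R (lhat m w - lam0)"
    have "\<bar>integral {0..1} (\<lambda>t. Q m w (?p t)) - A m w\<bar> \<le> C2 * dist (lhat m w) lam0 * V m w"
    proof (rule abs_integral_unit_diff_le)
      show "continuous_on {0..1} (\<lambda>t. Q m w (?p t))"
        by (rule continuous_on_compose2[OF Q_cont[OF w]]) (auto intro!: continuous_intros)
      fix t :: real assume t: "t \<in> {0..1}"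
      \<comment> \<open>Points of the segment are no farther from \<open>lam0\<close> than its
        endpoint, so the bound with the distance of the estimator holds for all \<open>t\<close> at
        once and passes to the integral.\<close>
      have d: "dist (?p t) lam0 \<le> dist (lhat m w) lam0"
        using t by (simp add: dist_norm mult_left_le_one_le)
      have "\<bar>Q m w (?p t) - A m w\<bar> \<le> C2 * dist (?p t) lam0 * V m w"
        by (rule Q_bnd[OF w]) (use d l in linarith)
      also have "\<dots> \<le> C2 * dist (lhat m w) lam0 * V m w"
        by (intro mult_right_mono mult_left_mono d V_nonneg) (simp add: C2_def)
      finally show "\<bar>Q m w (?p t) - A m w\<bar> \<le> C2 * dist (lhat m w) lam0 * V m w" .
    qed
    then show "\<bar>(1 / real (N m)) * integral {0..1} (\<lambda>t. Jn psi X (ns m) w (?p t) b c) - A m w\<bar>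
      \<le> C2 * dist (lhat m w) lam0 * V m w"
      by (simp add: Q_def)
  qed
  show "conv_in_prob M
       (\<lambda>m w. (1 / real (N m)) * integral {0..1}
          (\<lambda>t. Jn psi X (ns m) w ((theta0, gamma0 r eps) + t *\<^sub>R (lhat m w - (theta0, gamma0 r eps))) b c))
       (Ibar nu f r psi (theta0, gamma0 r eps) b c) \<and>
     conv_in_prob M
       (\<lambda>m w. (1 / real (N m)) * Jn psi X (ns m) w (lhat m w) b c)
       (Ibar nu f r psi (theta0, gamma0 r eps) b c)"
    using N3 N4 by (simp only: lam0_def Q_def)
qed

end
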